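(* Let $a,b,d\in\mathbb{Z}$ with $b\ge 1$ and $\gcd(a,b)=1$. Let $\ell$ be an odd prime divisor of $a+db$ and let $r$ be an integer with $0\le r<\ell$. Suppose that $d,\ell,r$ satisfy one of the following two conditions: \begin{enumerate} \item $d=2$, $\ell\equiv 3\pmod 4$ and $12r+5\equiv 0\pmod{\ell}$; \item $d=3$, $\ell\equiv 3\pmod 4$ and $8r+5\equiv 0\pmod{\ell}$. \end{enumerate} Then for all integers $n\ge 0$, $$p_{[1,4;-a/b]}(\ell n+r)\equiv 0\pmod{\ell}.$$
   Context: For a rational number $t$ and an integer $m>1$, the rational numbers $p_{[1,m;t]}(n)$, $n\ge 0$, are defined by the formal power series identity $\sum_{n\ge 0}p_{[1,m;t]}(n)q^n=\prod_{j\ge 1}\big((1-q^j)(1-q^{mj})\big)^t$, where each power is the binomial series with constant term $1$. For a prime $\ell$ not dividing the denominator of $t$, a congruence $p_{[1,m;t]}(N)\equiv 0\pmod{\ell^k}$ means that the numerator of $p_{[1,m;t]}(N)$, written as a reduced fraction, is divisible by $\ell^k$ (the denominator is then coprime to $\ell$). *)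

theory Defs
  imports "HOL-Analysis.Analysis" "HOL-Number_Theory.Cong"
    "HOL-Computational_Algebra.Computational_Algebra"
begin

unbundle no vec_syntax
unbundle fps_syntax

text \<open>Intended for \<^term>\<open>F $ 0 = 1\<close>: the binomial series \<open>(1 + x)\<^sup>t\<close> at \<open>x = F - 1\<close>.\<close>

definition fps_gpow :: "'a::field_char_0 fps \<Rightarrow> 'a \<Rightarrow> 'a fps" where
  "fps_gpow F t = fps_binomial t oo (F - 1)"

definition factor_1m :: "nat \<Rightarrow> nat \<Rightarrow> rat fps" where
  "factor_1m m j = (1 - fps_X ^ j) * (1 - fps_X ^ (m * j))"

text \<open>The infinite product is taken in the topology of coefficientwise stabilisation; the index
  is shifted because \<^const>\<open>prodinf\<close> starts at \<open>0\<close>. Convergence for \<open>m \<ge> 1\<close> is shown below.\<close>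

definition p_1m :: "nat \<Rightarrow> rat \<Rightarrow> nat \<Rightarrow> rat" where
  "p_1m m t n = (\<Prod>j. fps_gpow (factor_1m m (Suc j)) t) $ n"

text \<open>Since \<^const>\<open>quotient_of\<close> yields the reduced fraction, for \<open>M = \<ell>\<^sup>k\<close> with \<open>k \<ge> 1\<close>
  this forces the denominator to be coprime to \<open>\<ell>\<close>.\<close>

definition rat_cong_zero :: "rat \<Rightarrow> int \<Rightarrow> bool" where
  "rat_cong_zero x M \<longleftrightarrow> M dvd fst (quotient_of x)"

lemma fps_gpow_nth_0 [simp]: "fps_gpow F t $ 0 = 1"
  by (simp add: fps_gpow_def)

lemma fps_gpow_1:
  assumes "F $ 0 = 1"
  shows "fps_gpow F 1 = F"
  using assms by (simp add: fps_gpow_def fps_binomial_1 fps_compose_add_distrib)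

lemma fps_gpow_nth_eq_0:
  assumes "F = 1 + fps_X ^ N * h" "0 < k" "k < N"
  shows "fps_gpow F t $ k = 0"
proof -
  have "((F - 1) ^ i) $ k = 0" if "i > 0" for i
  proof -
    have "k < N * i"
      using mult_le_mono2[of 1 i N] that assms(3) by linarith
    then show ?thesis
      by (simp add: assms(1) power_mult_distrib fps_X_power_mult_nth flip: power_mult)
  qed
  then have "(t gchoose i) * ((F - 1) ^ i) $ k = 0" for i
    using assms(2) by (cases "i = 0") auto
  then show ?thesis
    by (simp only: fps_gpow_def fps_compose_nth fps_binomial_nth sum.neutral_const)
qed

lemma factor_1m_eq:
  assumes "m \<ge> 1"
  shows "\<exists>h. factor_1m m j = 1 + fps_X ^ j * h"
proof
  have "fps_X ^ (m * j) = (fps_X ^ j * fps_X ^ ((m - 1) * j) :: rat fps)"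
    using assms by (simp add: mult_eq_if flip: power_add)
  then show "factor_1m m j = 1 + fps_X ^ j * (fps_X ^ (m * j) - 1 - fps_X ^ ((m - 1) * j))"
    by (simp add: factor_1m_def algebra_simps)
qed

lemma p_1m_has_prod:
  assumes "m \<ge> 1"
  shows "(\<lambda>j. fps_gpow (factor_1m m (Suc j)) t) has_prod (Abs_fps (p_1m m t))"
proof -
  define f where "f = (\<lambda>j. fps_gpow (factor_1m m (Suc j)) t)"
  define P where "P = (\<lambda>n. \<Prod>j\<le>n. f j)"
  have f0: "f j $ 0 = 1" for j
    by (simp add: f_def)
  have fk: "f j $ k = 0" if "0 < k" "k \<le> j" for j k
  proof -
    obtain h where "factor_1m m (Suc j) = 1 + fps_X ^ Suc j * h"
      using factor_1m_eq[OF assms] by blast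
    then show ?thesis
      unfolding f_def by (rule fps_gpow_nth_eq_0) (use that in auto)
  qed
  have step: "P (Suc n) $ k = P n $ k" if "k \<le> n" for n k
  proof -
    have "P (Suc n) $ k = (\<Sum>i=0..k. P n $ i * f (Suc n) $ (k - i))"
      by (simp add: P_def fps_mult_nth)
    also have "\<dots> = (\<Sum>i=0..k. if i = k then P n $ k else 0)"
      using that by (intro sum.cong) (auto simp: f0 fk)
    finally show ?thesis by simp
  qed
  have stable: "P n $ k = P k $ k" if "k \<le> n" for n k
    using that by (induction n rule: dec_induct) (auto simp: step)
  define G where "G = Abs_fps (\<lambda>k. P k $ k)"
  have "P \<longlonglongrightarrow> G"
    by (rule tendsto_fpsI) (auto simp: G_def eventually_sequentially intro!: stable)
  moreover have "G $ 0 = 1"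
    by (simp add: G_def P_def f0)
  then have "G \<noteq> 0"
    by auto
  ultimately have "f has_prod G"
    by (simp add: has_prod_def raw_has_prod_def P_def)
  then have "prodinf f = G"
    by (rule has_prod_unique[symmetric])
  then have "Abs_fps (p_1m m t) = G"
    by (simp add: p_1m_def fps_eq_iff flip: f_def)
  with \<open>f has_prod G\<close> show ?thesis
    by (simp add: f_def)
qed

end

theory Submission
  imports Defs "HOL-Number_Theory.Residues"
begin

text \<open>Since \<open>-a/b\<close> is congruent to \<open>d\<close> modulo \<open>\<ell>\<close>, the generating function is \<open>(E\<^sub>1 E\<^sub>4)\<^sup>d H\<close>,
  where \<open>E\<^sub>m = \<Prod>\<^sub>j (1 - q\<^bsup>mj\<^esup>)\<close> and \<open>H\<close> is an \<open>\<ell>\<close>-th power to an \<open>\<ell>\<close>-integral exponent, hence modulo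
  \<open>\<ell>\<close> a series in \<open>q\<^bsup>\<ell>\<^esup>\<close>. It remains to see that \<open>\<ell>\<close> divides the coefficients of
  \<open>(E\<^sub>1 E\<^sub>4)\<^sup>d\<close> at the exponents congruent to \<open>r\<close>. By Jacobi's identity \<open>E\<^sub>1\<^sup>3 E\<^sub>4\<^sup>3\<close> is the sum of
  \<open>\<plusminus>(2i + 1)(2j + 1) q\<^sup>N\<close> with \<open>8N + 5 = (2i + 1)\<^sup>2 + 4(2j + 1)\<^sup>2\<close>, while \<open>E\<^sub>1\<^sup>2 E\<^sub>4\<^sup>2\<close> is the sum of
  \<open>\<plusminus>(3k + 1) q\<^sup>N\<close> with \<open>12N + 5 = 4(3k + 1)\<^sup>2 + (6j - 1)\<^sup>2\<close>. A prime \<open>\<ell> \<equiv> 3\<close> modulo 4 that divides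
  a sum of two squares divides both, so it divides these coefficients.\<close>

section \<open>The finite Jacobi triple product\<close>

definition qfac :: "'a::comm_ring_1 \<Rightarrow> nat \<Rightarrow> 'a" where
  "qfac q n = (\<Prod>i<n. 1 - q ^ Suc i)"

lemma qfac_0 [simp]: "qfac q 0 = 1"
  by (simp add: qfac_def)

lemma qfac_Suc [simp]: "qfac q (Suc n) = qfac q n * (1 - q ^ Suc n)"
  by (simp add: qfac_def)

lemma qfac_fps_nth_0 [simp]: "q $ 0 = 0 \<Longrightarrow> qfac q n $ 0 = 1"
  by (induction n) simp_all

text \<open>Gaussian binomial coefficients. If \<open>q\<close> has constant term 0, every
  \<open>qfac\<close> is invertible; the value 0 for \<open>k > n\<close> extends Pascal's rules to
  \<open>k = n\<close>.\<close>

definition qbin :: "'a::field fps \<Rightarrow> nat \<Rightarrow> nat \<Rightarrow> 'a fps" where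
  "qbin q n k = (if k \<le> n then qfac q n * inverse (qfac q k) * inverse (qfac q (n - k)) else 0)"

lemma qbin_0_0 [simp]: "qbin q 0 0 = 1"
  by (simp add: qbin_def)

lemma qbin_eq_0 [simp]: "n < k \<Longrightarrow> qbin q n k = 0"
  by (simp add: qbin_def)

lemma inverse_qfac:
  fixes q :: "'a::field fps"
  assumes "q $ 0 = 0"
  shows "inverse (qfac q n) = inverse (qfac q (Suc n)) * (1 - q ^ Suc n)"
proof -
  have "inverse (1 - q ^ Suc n) * (1 - q ^ Suc n) = 1"
    by (rule inverse_mult_eq_1) (use assms in simp)
  then show ?thesis by (simp add: fps_inverse_mult mult.assoc)
qed

lemma qbin_n_0 [simp]:
  fixes q :: "'a::field fps"
  assumes "q $ 0 = 0"
  shows "qbin q n 0 = 1"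
  using assms by (simp add: qbin_def inverse_mult_eq_1')

lemma qbin_n_n [simp]:
  fixes q :: "'a::field fps"
  assumes "q $ 0 = 0"
  shows "qbin q n n = 1"
  using assms by (simp add: qbin_def inverse_mult_eq_1')

text \<open>For \<open>k < n\<close>, put \<open>i = k + 1\<close> and \<open>j = n - k\<close>: the
  rules are the two splittings \<open>(1 - q^j) + q^j (1 - q^i)\<close> and
  \<open>q^i (1 - q^j) + (1 - q^i)\<close> of \<open>1 - q^(i + j)\<close>.\<close>

lemma qbin_pascal:
  fixes q :: "'a::field fps"
  assumes "q $ 0 = 0" and "k \<le> n"
  shows "qbin q (Suc n) (Suc k) = qbin q n (Suc k) + q ^ (n - k) * qbin q n k"
    and "qbin q (Suc n) (Suc k) = q ^ Suc k * qbin q n (Suc k) + qbin q n k"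
proof -
  have "qbin q (Suc n) (Suc k) = qbin q n (Suc k) + q ^ (n - k) * qbin q n k \<and>
    qbin q (Suc n) (Suc k) = q ^ Suc k * qbin q n (Suc k) + qbin q n k"
  proof (cases "k = n")
    case True
    with assms show ?thesis by simp
  next
    case False
    with assms(2) obtain j where n: "n = Suc (k + j)"
      using less_imp_Suc_add by (metis le_neq_implies_less)
    define A where "A = qfac q n * inverse (qfac q (Suc k)) * inverse (qfac q (Suc j))"
    have "qbin q (Suc n) (Suc k) = A * (1 - q ^ (Suc k + Suc j))"
      by (simp add: qbin_def n A_def mult_ac)
    moreover have "qbin q n (Suc k) = A * (1 - q ^ Suc j)"
      using inverse_qfac[OF assms(1), of j] by (simp add: qbin_def n A_def mult_ac del: qfac_Suc)
    moreover have "qbin q n k = A * (1 - q ^ Suc k)"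
      using inverse_qfac[OF assms(1), of k]
      by (simp add: qbin_def n A_def mult_ac Suc_diff_le del: qfac_Suc)
    moreover have "n - k = Suc j" by (simp add: n)
    moreover have "A * (1 - q ^ (Suc k + Suc j)) = A * (1 - q ^ Suc j) + q ^ Suc j * (A * (1 - q ^ Suc k))"
      "A * (1 - q ^ (Suc k + Suc j)) = q ^ Suc k * (A * (1 - q ^ Suc j)) + A * (1 - q ^ Suc k)"
      by (simp_all add: algebra_simps power_add)
    ultimately show ?thesis by metis
  qed
  then show "qbin q (Suc n) (Suc k) = qbin q n (Suc k) + q ^ (n - k) * qbin q n k"
    and "qbin q (Suc n) (Suc k) = q ^ Suc k * qbin q n (Suc k) + qbin q n k"
    by auto
qed

section \<open>Triangular numbers and the monomials of the triple product\<close>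

definition tri :: "int \<Rightarrow> nat" where
  "tri k = nat (k * (k + 1) div 2)"

lemma int_tri: "2 * int (tri k) = k * (k + 1)"
proof -
  have "k * (k + 1) \<ge> 0"
    by (cases "k \<ge> 0") (auto intro: mult_nonpos_nonpos)
  moreover have "even (k * (k + 1))" by simp
  ultimately show ?thesis by (simp add: tri_def)
qed

text \<open>The monomial \<open>z\<^sup>k q\<^bsup>k(k+1)/2\<^esup>\<close> of the triple product, written in Ramanujan's variables
  \<open>a = zq\<close>, \<open>b = 1/z\<close>, so that no negative exponents occur.\<close>

definition tmon :: "'a::comm_ring_1 \<Rightarrow> 'a \<Rightarrow> int \<Rightarrow> 'a" where
  "tmon a b k = a ^ tri k * b ^ tri (k - 1)"

text \<open>Passing from \<open>k\<close> to \<open>k + 1\<close> multiplies the monomial, formally,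
  by \<open>a * (a * b)^k\<close>; the power \<open>m - k\<close> supplied by Pascal's rule makes
  the total factor independent of \<open>k\<close>.\<close>

lemma tmon_shift_left:
  assumes "k \<le> int m"
  shows "(a * b) ^ nat (int m - k) * tmon a b (k + 1) = a * (a * b) ^ m * tmon a b k"
proof -
  have "2 * int (nat (int m - k) + tri (k + 1)) = 2 * int (Suc m + tri k)"
    unfolding of_nat_add distrib_left int_tri using assms by (simp add: algebra_simps)
  then have "nat (int m - k) + tri (k + 1) = Suc m + tri k"
    by (simp only: mult_cancel_left of_nat_eq_iff) simp
  moreover have "2 * int (nat (int m - k) + tri k) = 2 * int (m + tri (k - 1))"
    unfolding of_nat_add distrib_left int_tri using assms by (simp add: algebra_simps)
  then have "nat (int m - k) + tri k = m + tri (k - 1)"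
    by (simp only: mult_cancel_left of_nat_eq_iff) simp
  moreover have "(a * b) ^ nat (int m - k) * tmon a b (k + 1)
      = a ^ (nat (int m - k) + tri (k + 1)) * b ^ (nat (int m - k) + tri k)"
    by (simp add: tmon_def power_mult_distrib power_add mult_ac)
  ultimately show ?thesis
    by (simp add: tmon_def power_mult_distrib power_add mult_ac)
qed

lemma tmon_swap: "tmon a b k = tmon b a (- k)"
proof -
  have "2 * int (tri k) = 2 * int (tri (- k - 1))" "2 * int (tri (k - 1)) = 2 * int (tri (- k))"
    unfolding int_tri by (simp_all add: algebra_simps)
  then show ?thesis by (simp add: tmon_def mult_ac)
qed

lemma tmon_shift_right:
  assumes "- k \<le> int n"
  shows "(a * b) ^ nat (int n + k) * tmon a b (k - 1) = b * (a * b) ^ n * tmon a b k"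
  using tmon_shift_left[OF assms, of b a] tmon_swap[of a b k] tmon_swap[of a b "k - 1"]
  by (simp add: mult_ac)

text \<open>The weight \<open>w\<close> is there for the \<open>z\<close>-derivative of the triple product at \<open>z = 1\<close>, which turns into
  a sum with a weight that is linear in \<open>k\<close>.\<close>

definition jsum :: "'a::field fps \<Rightarrow> 'a fps \<Rightarrow> (int \<Rightarrow> 'a fps) \<Rightarrow> nat \<Rightarrow> nat \<Rightarrow> 'a fps" where
  "jsum a b w m n = (\<Sum>K\<le>m + n. w (int K - int n) * tmon a b (int K - int n)
     * qbin (a * b) (m + n) K)"

context
  fixes a b :: "'a::field fps"
  assumes ab: "(a * b) $ 0 = 0"
begin

text \<open>Pascal's first rule splits the sum. One part is the old sum; in the other, shifting the
  monomial turns all powers of \<open>a * b\<close> into one common factor, and only the weight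
  records the shift of \<open>k\<close>.\<close>

lemma jsum_Suc_left:
  "jsum a b w (Suc m) n = jsum a b w m n + a * (a * b) ^ m * jsum a b (\<lambda>k. w (k + 1)) m n"
proof -
  define q where "q = a * b"
  define u where "u K = w (int K - int n) * tmon a b (int K - int n)" for K
  note q0 = ab[folded q_def]
  have u: "u (Suc K) * q ^ (m + n - K)
      = a * q ^ m * (w (int K - int n + 1) * tmon a b (int K - int n))" if "K \<le> m + n" for K
  proof -
    have eqs: "nat (int m - (int K - int n)) = m + n - K" "int (Suc K) - int n = int K - int n + 1"
      by linarith+
    then show ?thesis
      using tmon_shift_left[of "int K - int n" m a b] that
      unfolding u_def q_def eqs by (simp add: mult_ac)
  qed
  have "jsum a b w (Suc m) n = u 0 + (\<Sum>K\<le>m + n. u (Suc K) * qbin q (Suc (m + n)) (Suc K))"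
    unfolding jsum_def q_def[symmetric] add_Suc sum.atMost_Suc_shift
    using q0 by (simp add: u_def)
  also have "\<dots> = (u 0 + (\<Sum>K\<le>m + n. u (Suc K) * qbin q (m + n) (Suc K)))
      + (\<Sum>K\<le>m + n. u (Suc K) * q ^ (m + n - K) * qbin q (m + n) K)"
    using q0 by (simp add: qbin_pascal(1) algebra_simps sum.distrib)
  also have "u 0 + (\<Sum>K\<le>m + n. u (Suc K) * qbin q (m + n) (Suc K)) = (\<Sum>K\<le>Suc (m + n). u K * qbin q (m + n) K)"
    unfolding sum.atMost_Suc_shift using q0 by simp
  also have "\<dots> = jsum a b w m n"
    by (simp add: jsum_def u_def q_def)
  also have "(\<Sum>K\<le>m + n. u (Suc K) * q ^ (m + n - K) * qbin q (m + n) K)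
    = a * q ^ m * jsum a b (\<lambda>k. w (k + 1)) m n"
    unfolding jsum_def sum_distrib_left q_def[symmetric]
    by (rule sum.cong) (simp_all add: u mult.assoc)
  finally show ?thesis by (simp add: q_def)
qed

lemma jsum_Suc_right:
  "jsum a b w m (Suc n) = jsum a b w m n + b * (a * b) ^ n * jsum a b (\<lambda>k. w (k - 1)) m n"
proof -
  define q where "q = a * b"
  define u where "u K = w (int K - int (Suc n)) * tmon a b (int K - int (Suc n))" for K
  note q0 = ab[folded q_def]
  have u: "u K * q ^ K = b * q ^ n * (w (int K - int n - 1) * tmon a b (int K - int n))" for K
    using tmon_shift_right[of "int K - int n" n a b]
    by (simp add: u_def q_def mult_ac diff_diff_eq add.commute)
  have "jsum a b w m (Suc n) = u 0 + (\<Sum>K\<le>m + n. u (Suc K) * qbin q (Suc (m + n)) (Suc K))"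
    unfolding jsum_def q_def[symmetric] add_Suc_right sum.atMost_Suc_shift
    using q0 by (simp add: u_def)
  also have "\<dots> = (u 0 + (\<Sum>K\<le>m + n. u (Suc K) * q ^ Suc K * qbin q (m + n) (Suc K)))
      + (\<Sum>K\<le>m + n. u (Suc K) * qbin q (m + n) K)"
    using q0 by (simp add: qbin_pascal(2) algebra_simps sum.distrib)
  also have "u 0 + (\<Sum>K\<le>m + n. u (Suc K) * q ^ Suc K * qbin q (m + n) (Suc K))
      = (\<Sum>K\<le>Suc (m + n). u K * q ^ K * qbin q (m + n) K)"
    unfolding sum.atMost_Suc_shift using q0 by simp
  also have "\<dots> = b * q ^ n * jsum a b (\<lambda>k. w (k - 1)) m n"
    unfolding u by (simp add: jsum_def sum_distrib_left q_def mult.assoc)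
  also have "(\<Sum>K\<le>m + n. u (Suc K) * qbin q (m + n) K) = jsum a b w m n"
    by (simp add: jsum_def u_def q_def)
  finally show ?thesis by (simp add: q_def)
qed

lemma jsum_0_0: "jsum a b w 0 0 = w 0"
  by (simp add: jsum_def tmon_def tri_def)

text \<open>The shifts leave a constant weight unchanged, so each recurrence multiplies the sum by
  one factor of the product.\<close>

lemma jacobi_triple_finite:
  "jsum a b (\<lambda>_. 1) m n = (\<Prod>i<m. 1 + a * (a * b) ^ i) * (\<Prod>i<n. 1 + b * (a * b) ^ i)"
proof (induction m)
  case 0
  show ?case
    by (induction n) (simp_all add: jsum_0_0 jsum_Suc_right algebra_simps)
next
  case (Suc m)
  then show ?case by (simp add: jsum_Suc_left algebra_simps)
qed

end

section \<open>Theta series as limits\<close>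

lemma tendsto_mult_fps:
  fixes A B :: "'a::ring fps"
  assumes "(f \<longlongrightarrow> A) F" and "(g \<longlongrightarrow> B) F"
  shows "((\<lambda>x. f x * g x) \<longlongrightarrow> A * B) F"
proof (rule tendsto_fpsI)
  fix n
  have "\<forall>\<^sub>F x in F. \<forall>k\<le>n. f x $ k = A $ k" "\<forall>\<^sub>F x in F. \<forall>k\<le>n. g x $ k = B $ k"
    using assms by (auto intro: eventually_compose_filterlim eventually_fps_nth_eq_nhds_fps_strong)
  then show "\<forall>\<^sub>F x in F. (f x * g x) $ n = (A * B) $ n"
    by eventually_elim (auto simp: fps_mult_nth intro!: sum.cong)
qed

text \<open>The series with terms \<open>w k * q^(e k)\<close>, given by its coefficients. It has
  this meaning when the fibres of \<open>e\<close> are finite; an infinite fibre would contribute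
  0.\<close>

definition theta :: "('i \<Rightarrow> 'a::comm_ring_1) \<Rightarrow> ('i \<Rightarrow> int) \<Rightarrow> 'a fps" where
  "theta w e = Abs_fps (\<lambda>n. \<Sum>k | e k = int n. w k)"

text \<open>The bound confines a fibre to an interval. The summand 1 admits exponents such as
  \<open>tri (- 1) = 0\<close>.\<close>

lemma finite_theta_fiber:
  fixes e :: "int \<Rightarrow> int"
  assumes "\<And>k. \<bar>k\<bar> \<le> e k + 1"
  shows "finite {k. e k = n}"
proof (rule finite_subset)
  show "{k. e k = n} \<subseteq> {- (n + 1)..n + 1}"
  proof
    fix k assume "k \<in> {k. e k = n}"
    with assms[of k] show "k \<in> {- (n + 1)..n + 1}" by auto
  qed
qed simp

text \<open>Up to a given degree only the finitely many \<open>k\<close> with small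
  \<open>e k\<close> contribute, so the limits of the \<open>c N k\<close> can be taken term by
  term.\<close>

lemma tendsto_theta:
  fixes e :: "int \<Rightarrow> int" and C :: "'a::comm_ring_1 fps"
  assumes e: "\<And>k. \<bar>k\<bar> \<le> e k + 1" and e0: "\<And>k. 0 \<le> e k"
    and c: "\<And>k. (\<lambda>N. c N k) \<longlonglongrightarrow> C"
  shows "(\<lambda>N. \<Sum>k\<in>{- int N..int N}. fps_const (w k) * fps_X ^ nat (e k) * c N k)
    \<longlonglongrightarrow> theta w e * C"
proof (rule tendsto_fpsI)
  fix n
  define I where "I = {- (int n + 1)..int n + 1}"
  have "finite I" by (simp add: I_def)
  have I: "k \<in> I" if "e k \<le> int n" for k
    using e[of k] that by (auto simp: I_def)
  have "\<forall>\<^sub>F N in sequentially. \<forall>k\<in>I. \<forall>j\<le>n. c N k $ j = C $ j"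
    by (intro eventually_ball_finite ballI \<open>finite I\<close> eventually_compose_filterlim[OF _ c]
        eventually_fps_nth_eq_nhds_fps_strong)
  then show "\<forall>\<^sub>F N in sequentially.
      (\<Sum>k\<in>{- int N..int N}. fps_const (w k) * fps_X ^ nat (e k) * c N k) $ n = (theta w e * C) $ n"
    using eventually_ge_at_top[of "Suc n"]
  proof eventually_elim
    case (elim N)
    have "(\<Sum>k\<in>{- int N..int N}. fps_const (w k) * fps_X ^ nat (e k) * c N k) $ n
        = (\<Sum>k\<in>{- int N..int N}. if e k \<le> int n then w k * c N k $ (n - nat (e k)) else 0)"
      unfolding fps_sum_nth mult.assoc fps_mult_left_const_nth fps_X_power_mult_nth
      using e0 by (intro sum.cong refl) (use e0 in \<open>auto simp: nat_le_iff\<close>)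
    also have "\<dots> = (\<Sum>k\<in>I. if e k \<le> int n then w k * c N k $ (n - nat (e k)) else 0)"
      using I elim(2) by (intro sum.mono_neutral_right) (auto simp: I_def)
    also have "\<dots> = (\<Sum>k\<in>I. if e k \<le> int n then w k * C $ (n - nat (e k)) else 0)"
      using elim(1) by (intro sum.cong) auto
    also have "\<dots> = (\<Sum>k | e k \<le> int n. w k * C $ (n - nat (e k)))"
      unfolding sum.inter_filter[OF \<open>finite I\<close>, symmetric] using I by (intro sum.cong) auto
    also have "\<dots> = (\<Sum>j\<in>{0..n}. \<Sum>k | k \<in> {k. e k \<le> int n} \<and> nat (e k) = j. w k * C $ (n - nat (e k)))"
    proof (intro sum.group[symmetric])
      show "finite {k. e k \<le> int n}"
        using I by (intro finite_subset[OF _ \<open>finite I\<close>]) auto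
    qed (auto simp: nat_le_iff)
    also have "\<dots> = (theta w e * C) $ n"
      unfolding fps_mult_nth theta_def
    proof (intro sum.cong refl)
      fix j assume "j \<in> {0..n}"
      then have "{k. k \<in> {k. e k \<le> int n} \<and> nat (e k) = j} = {k. e k = int j}"
        using e0 by auto
      then show "(\<Sum>k | k \<in> {k. e k \<le> int n} \<and> nat (e k) = j. w k * C $ (n - nat (e k)))
          = Abs_fps (\<lambda>n. \<Sum>k | e k = int n. w k) $ j * C $ (n - j)"
        by (simp add: sum_distrib_right)
    qed
    finally show ?case .
  qed
qed

text \<open>The infinite product of the \<open>1 - q^(m * j)\<close>: for \<open>m >= 1\<close>, the
  factors after the \<open>n\<close>-th no longer affect the coefficient of
  \<open>q^n\<close>.\<close>

definition euler_fps :: "nat \<Rightarrow> 'a::comm_ring_1 fps" where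
  "euler_fps m = Abs_fps (\<lambda>n. qfac (fps_X ^ m) n $ n)"

lemma tendsto_euler_fps:
  assumes "m \<ge> 1"
  shows "qfac (fps_X ^ m) \<longlonglongrightarrow> (euler_fps m :: 'a::comm_ring_1 fps)"
proof (rule tendsto_fpsI)
  fix n
  have "qfac (fps_X ^ m) N $ n = (qfac (fps_X ^ m) n :: 'a fps) $ n" if "n \<le> N" for N
    using that
  proof (induction N rule: dec_induct)
    case (step N)
    have "Suc N \<le> m * Suc N"
      using mult_le_mono1[OF assms, of "Suc N"] by (simp only: mult_1)
    with step(1) have "n < m * Suc N" by linarith
    with step.IH show ?case
      by (simp add: right_diff_distrib fps_X_power_mult_right_nth flip: power_mult power_Suc)
  qed simp
  then show "\<forall>\<^sub>F N in sequentially. qfac (fps_X ^ m) N $ n = (euler_fps m :: 'a fps) $ n"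
    unfolding euler_fps_def eventually_sequentially fps_nth_Abs_fps by blast
qed

lemma euler_fps_nth_0 [simp]: "euler_fps m $ 0 = 1"
  by (simp add: euler_fps_def)

lemma euler_fps_nonzero [simp]: "euler_fps m \<noteq> (0 :: 'a::comm_ring_1 fps)"
  using euler_fps_nth_0[of m] by (metis fps_zero_nth zero_neq_one)

text \<open>The numerator and both denominators tend to \<open>euler_fps m\<close>, which leaves a
  single inverse.\<close>

lemma tendsto_qbin:
  assumes "m \<ge> 1"
  shows "(\<lambda>N. qbin (fps_X ^ m) (N + N) (nat (k + int N)))
    \<longlonglongrightarrow> inverse (euler_fps m :: 'a::field fps)"
proof -
  let ?q = "fps_X ^ m :: 'a fps"
  note lim = filterlim_compose[OF tendsto_euler_fps[OF assms]]
  have nat_at_top: "filterlim (\<lambda>N. nat (i + int N)) at_top sequentially" for i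
    unfolding filterlim_at_top
  proof
    fix Z
    show "\<forall>\<^sub>F N in sequentially. Z \<le> nat (i + int N)"
      using eventually_ge_at_top[of "Z + nat \<bar>i\<bar>"] by eventually_elim linarith
  qed
  have lim: "(\<lambda>N. qfac ?q (N + N) * inverse (qfac ?q (nat (k + int N)))
      * inverse (qfac ?q (nat (- k + int N))))
      \<longlonglongrightarrow> euler_fps m * inverse (euler_fps m) * inverse (euler_fps m)"
    by (intro tendsto_mult_fps tendsto_inverse_fps lim nat_at_top)
       (auto intro!: filterlim_subseq strict_monoI)
  have one: "euler_fps m * inverse (euler_fps m) = (1 :: 'a fps)"
    by (rule inverse_mult_eq_1') simp
  have "\<forall>\<^sub>F N in sequentially. qfac ?q (N + N) * inverse (qfac ?q (nat (k + int N)))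
      * inverse (qfac ?q (nat (- k + int N))) = qbin ?q (N + N) (nat (k + int N))"
    using eventually_ge_at_top[of "nat \<bar>k\<bar>"]
  proof eventually_elim
    case (elim N)
    then have "N + N - nat (k + int N) = nat (- k + int N)" "nat (k + int N) \<le> N + N"
      by linarith+
    then show ?case by (simp add: qbin_def)
  qed
  from Lim_transform_eventually[OF lim this] show ?thesis
    unfolding one mult_1_left .
qed

text \<open>The weighted triple product in the limit: multiplication by \<open>euler_fps m\<close>
  cancels the limit of the Gaussian binomials.\<close>

lemma tendsto_jsum:
  fixes a b :: "'a::field fps"
  assumes ab: "a * b = fps_X ^ m" and m: "m \<ge> 1"
    and e: "\<And>k. \<bar>k\<bar> \<le> e k + 1" and e0: "\<And>k. 0 \<le> e k"
    and T: "\<And>k. tmon a b k = fps_const (s k) * fps_X ^ nat (e k)"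
  shows "(\<lambda>N. jsum a b (\<lambda>k. fps_const (v k)) N N * euler_fps m) \<longlonglongrightarrow> theta (\<lambda>k. v k * s k) e"
proof -
  have "jsum a b (\<lambda>k. fps_const (v k)) N N
    = (\<Sum>k\<in>{- int N..int N}. fps_const (v k * s k) * fps_X ^ nat (e k)
        * qbin (fps_X ^ m) (N + N) (nat (k + int N)))" for N
    unfolding jsum_def ab T
    by (rule sum.reindex_bij_witness[of _ "\<lambda>k. nat (k + int N)" "\<lambda>K. int K - int N"])
       (auto simp: mult.assoc fps_const_mult[symmetric] simp del: fps_const_mult)
  then have "(\<lambda>N. jsum a b (\<lambda>k. fps_const (v k)) N N) \<longlonglongrightarrow>
      theta (\<lambda>k. v k * s k) e * inverse (euler_fps m)"
    by (simp only: tendsto_theta[OF e e0 tendsto_qbin[OF m]])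
  from tendsto_mult_fps[OF this tendsto_const[of "euler_fps m"]] show ?thesis
    by (simp add: mult.assoc inverse_mult_eq_1)
qed

section \<open>Products of theta series\<close>

lemma finite_fiber_pair:
  fixes e :: "'i \<Rightarrow> int" and e' :: "'j \<Rightarrow> int"
  assumes "\<And>i. 0 \<le> e i" "\<And>n. finite {i. e i = n}" "\<And>j. 0 \<le> e' j" "\<And>n. finite {j. e' j = n}"
  shows "finite {(i, j). e i + e' j = n}"
proof (rule finite_subset)
  show "{(i, j). e i + e' j = n} \<subseteq> (\<Union>m\<in>{0..n}. {i. e i = m} \<times> {j. e' j = n - m})"
    using assms(1,3) by (auto intro: order_trans[OF _ add_increasing2])
qed (use assms in simp)

lemma theta_mult:
  fixes e :: "'i \<Rightarrow> int" and e' :: "'j \<Rightarrow> int"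
  assumes "\<And>i. 0 \<le> e i" "\<And>n. finite {i. e i = n}" "\<And>j. 0 \<le> e' j" "\<And>n. finite {j. e' j = n}"
  shows "theta w e * theta w' e' = theta (\<lambda>(i, j). w i * w' j) (\<lambda>(i, j). e i + e' j)"
  unfolding fps_eq_iff
proof
  fix n
  have "(theta w e * theta w' e') $ n
      = (\<Sum>m=0..n. \<Sum>(i, j)\<in>{i. e i = int m} \<times> {j. e' j = int (n - m)}. w i * w' j)"
    by (simp add: fps_mult_nth theta_def sum_product sum.cartesian_product)
  also have "\<dots> = (\<Sum>m\<in>{0..n}. \<Sum>(i, j) | (i, j) \<in> {(i, j). e i + e' j = int n} \<and> nat (e i) = m. w i * w' j)"
  proof (intro sum.cong refl)
    fix m assume "m \<in> {0..n}"
    then show "{i. e i = int m} \<times> {j. e' j = int (n - m)}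
        = {x. case x of (i, j) \<Rightarrow> (i, j) \<in> {(i, j). e i + e' j = int n} \<and> nat (e i) = m}"
      using assms(1) by (auto simp: of_nat_diff)
  qed
  also have "\<dots> = (\<Sum>m\<in>{0..n}. \<Sum>x | x \<in> {(i, j). e i + e' j = int n} \<and> nat (e (fst x)) = m.
      (case x of (i, j) \<Rightarrow> w i * w' j))"
    by (intro sum.cong refl) auto
  also have "\<dots> = (\<Sum>x \<in> {(i, j). e i + e' j = int n}. (case x of (i, j) \<Rightarrow> w i * w' j))"
  proof (intro sum.group)
    show "finite {(i, j). e i + e' j = int n}"
      by (rule finite_fiber_pair) (use assms in auto)
    show "(\<lambda>x. nat (e (fst x))) ` {(i, j). e i + e' j = int n} \<subseteq> {0..n}"
    proof safe
      fix i j assume "e i + e' j = int n"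
      with assms(3)[of j] show "nat (e (fst (i, j))) \<in> {0..n}" by simp
    qed
  qed simp
  also have "\<dots> = theta (\<lambda>(i, j). w i * w' j) (\<lambda>(i, j). e i + e' j) $ n"
    by (simp add: theta_def case_prod_unfold)
  finally show "(theta w e * theta w' e') $ n = theta (\<lambda>(i, j). w i * w' j) (\<lambda>(i, j). e i + e' j) $ n" .
qed

definition sg :: "int \<Rightarrow> 'a::comm_ring_1" where
  "sg k = (if even k then 1 else - 1)"

lemma tri_ge: "\<bar>k\<bar> \<le> int (tri k) + 1"
proof -
  have "k * k - k \<ge> 0" if "k \<ge> 0" using that
    by (cases "k = 0") (auto simp: mult_le_cancel_left1)
  moreover have "(- 1 - k) * (- 2 - k) \<ge> 0" if "k < 0"
    using that by (cases "k = - 1") auto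
  ultimately have "2 * \<bar>k\<bar> \<le> 2 * (int (tri k) + 1)"
    unfolding distrib_left int_tri by (cases "k \<ge> 0") (auto simp: algebra_simps)
  then show ?thesis by simp
qed

lemma tri_add_tri: "int (tri k + tri (k - 1)) = k\<^sup>2"
proof -
  have "2 * int (tri k + tri (k - 1)) = 2 * k\<^sup>2"
    unfolding of_nat_add distrib_left int_tri by (simp add: algebra_simps power2_eq_square)
  then show ?thesis by simp
qed

text \<open>The sign is that of \<open>k^2\<close>, since \<open>tri k + tri (k - 1) = k^2\<close>,
  and \<open>k^2\<close> has the parity of \<open>k\<close>.\<close>

lemma tmon_neg_power:
  fixes x :: "'a::comm_ring_1"
  shows "tmon (- x) (- (x ^ s)) k = sg k * x ^ (tri k + s * tri (k - 1))"
proof -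
  have "even (tri k + tri (k - 1)) \<longleftrightarrow> even (k\<^sup>2)"
    using tri_add_tri[of k] even_of_nat by metis
  moreover have "tmon (- x) (- (x ^ s)) k
      = (- 1) ^ (tri k + tri (k - 1)) * x ^ (tri k + s * tri (k - 1))"
    unfolding tmon_def
    by (subst (1 2) power_minus) (simp add: power_add power_mult mult_ac)
  ultimately show ?thesis
    by (auto simp: sg_def)
qed

text \<open>For \<open>m = 1\<close> these are the triangular numbers (\<open>s = 0\<close>), the squares (\<open>s = 1\<close>) and the pentagonal
  numbers (\<open>s = 2\<close>).\<close>

definition tri_exp :: "nat \<Rightarrow> nat \<Rightarrow> int \<Rightarrow> int" where
  "tri_exp m s k = int (m * (tri k + s * tri (k - 1)))"

lemma tri_exp_nonneg [simp]: "0 \<le> tri_exp m s k"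
  by (simp add: tri_exp_def)

lemma tri_exp_ge:
  assumes "m \<ge> 1"
  shows "\<bar>k\<bar> \<le> tri_exp m s k + 1"
proof -
  have "tri k \<le> m * (tri k + s * tri (k - 1))"
    using mult_le_mono[OF assms, of "tri k" "tri k + s * tri (k - 1)"] by simp
  then show ?thesis
    using tri_ge[of k] unfolding tri_exp_def by linarith
qed

lemmas finite_tri_exp_fiber = finite_theta_fiber[OF tri_exp_ge]

text \<open>The case \<open>a = - x\<close>, \<open>b = - x^s\<close> with \<open>x = q^m\<close>,
  so that \<open>a * b = q^(m * Suc s)\<close>.\<close>

lemma tendsto_jsum_tri:
  fixes v :: "int \<Rightarrow> 'a::field"
  assumes "m \<ge> 1"
  shows "(\<lambda>N. jsum (- (fps_X ^ m)) (- ((fps_X ^ m) ^ s)) (\<lambda>k. fps_const (v k)) N N * euler_fps (m * Suc s))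
    \<longlonglongrightarrow> theta (\<lambda>k. v k * sg k) (tri_exp m s)"
proof (rule tendsto_jsum)
  show "- (fps_X ^ m) * - ((fps_X ^ m) ^ s) = (fps_X ^ (m * Suc s) :: 'a fps)"
    by (simp add: power_add power_mult)
  fix k
  have "fps_const (sg k) = (sg k :: 'a fps)"
    by (simp add: sg_def flip: fps_const_neg)
  then show "tmon (- (fps_X ^ m)) (- ((fps_X ^ m) ^ s)) k = fps_const (sg k :: 'a) * fps_X ^ nat (tri_exp m s k)"
    unfolding tmon_neg_power tri_exp_def nat_int by (simp flip: power_mult)
qed (use assms tri_exp_ge in simp_all)

section \<open>The identities of Euler, Gauss and Jacobi\<close>

text \<open>For \<open>a = - x\<close>, \<open>b = - x^2\<close> the product has the exponents
  congruent to 1 and 2 modulo 3; \<open>qfac (x ^ 3) N\<close> supplies the multiples of 3.\<close>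

lemma euler_pentagonal:
  assumes "m \<ge> 1"
  shows "theta sg (tri_exp m 2) = (euler_fps m :: 'a::field fps)"
proof -
  define x :: "'a fps" where "x = fps_X ^ m"
  have x0: "(- x * - (x ^ 2)) $ 0 = 0"
    using assms by (simp add: x_def fps_power_zeroth)
  have j: "jsum (- x) (- (x ^ 2)) (\<lambda>_. 1) N N * qfac (x ^ 3) N = qfac x (3 * N)" for N
  proof (induction N)
    case (Suc N)
    have *: "3 * Suc N = Suc (Suc (Suc (3 * N)))" by simp
    have "jsum (- x) (- (x ^ 2)) (\<lambda>_. 1) (Suc N) (Suc N) * qfac (x ^ 3) (Suc N)
      = (jsum (- x) (- (x ^ 2)) (\<lambda>_. 1) N N * qfac (x ^ 3) N)
       * ((1 - x * (x ^ 3) ^ N) * (1 - x\<^sup>2 * (x ^ 3) ^ N) * (1 - (x ^ 3) ^ Suc N))"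
      unfolding jacobi_triple_finite[OF x0] by (simp add: mult_ac flip: power_Suc power_Suc2 power_add)
    also have "\<dots> = qfac x (3 * Suc N)"
      unfolding * qfac_Suc Suc.IH power_Suc power_mult[symmetric]
      by (simp add: mult_ac power2_eq_square power3_eq_cube)
    finally show ?case .
  qed (simp add: jacobi_triple_finite[OF x0])
  have lim1: "(\<lambda>N. jsum (- x) (- (x ^ 2)) (\<lambda>_. fps_const 1) N N * euler_fps (m * Suc 2) * qfac (x ^ 3) N)
     \<longlonglongrightarrow> theta (\<lambda>k. 1 * sg k) (tri_exp m 2) * euler_fps (m * 3)"
    unfolding x_def
    by (intro tendsto_mult_fps tendsto_jsum_tri) (use assms tendsto_euler_fps[of "m * 3"] in \<open>simp_all add: power_mult\<close>)
  have lim2: "(\<lambda>N. qfac x (3 * N) * euler_fps (m * 3)) \<longlonglongrightarrow> euler_fps m * euler_fps (m * 3)"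
    unfolding x_def
    by (intro tendsto_mult_fps tendsto_const filterlim_compose[OF tendsto_euler_fps[OF assms]])
       (auto intro!: filterlim_subseq strict_monoI)
  have eq: "jsum (- x) (- (x ^ 2)) (\<lambda>_. fps_const 1) N N * euler_fps (m * Suc 2) * qfac (x ^ 3) N
      = qfac x (3 * N) * euler_fps (m * 3)" for N
    using j[of N] by (simp add: mult_ac)
  from lim1[unfolded eq] lim2 have "theta (\<lambda>k. 1 * sg k) (tri_exp m 2) * euler_fps (m * 3) = (euler_fps m * euler_fps (m * 3) :: 'a fps)"
    by (rule LIMSEQ_unique)
  then show ?thesis by simp
qed

text \<open>For \<open>a = b = - x\<close> the product has every odd exponent twice; two copies of
  \<open>qfac (x ^ 2) N\<close> supply the even ones.\<close>

lemma gauss_square: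
  assumes "m \<ge> 1"
  shows "theta sg (tri_exp m 1) * euler_fps (2 * m) = (euler_fps m ^ 2 :: 'a::field fps)"
proof -
  define x :: "'a fps" where "x = fps_X ^ m"
  have x0: "(- x * - (x ^ 1)) $ 0 = 0"
    using assms by (simp add: x_def fps_power_zeroth)
  have j: "jsum (- x) (- (x ^ 1)) (\<lambda>_. 1) N N * qfac (x ^ 2) N ^ 2 = qfac x (2 * N) ^ 2" for N
  proof (induction N)
    case (Suc N)
    have *: "2 * Suc N = Suc (Suc (2 * N))" by simp
    have "jsum (- x) (- (x ^ 1)) (\<lambda>_. 1) (Suc N) (Suc N) * qfac (x ^ 2) (Suc N) ^ 2
      = (jsum (- x) (- (x ^ 1)) (\<lambda>_. 1) N N * qfac (x ^ 2) N ^ 2)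
       * ((1 - x * (x ^ 2) ^ N) * (1 - (x ^ 2) ^ Suc N)) ^ 2"
      unfolding jacobi_triple_finite[OF x0] by (simp add: mult_ac power2_eq_square)
    also have "\<dots> = qfac x (2 * Suc N) ^ 2"
      unfolding * qfac_Suc Suc.IH power_Suc power_mult[symmetric]
      by (simp add: mult_ac power2_eq_square)
    finally show ?case .
  next
    case 0
    show ?case unfolding jacobi_triple_finite[OF x0] by simp
  qed
  have lim1: "(\<lambda>N. jsum (- x) (- (x ^ 1)) (\<lambda>_. fps_const 1) N N * euler_fps (m * Suc 1) * (qfac (x ^ 2) N * qfac (x ^ 2) N))
     \<longlonglongrightarrow> theta (\<lambda>k. 1 * sg k) (tri_exp m 1) * (euler_fps (m * 2) * euler_fps (m * 2))"
    unfolding x_def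
    by (intro tendsto_mult_fps tendsto_jsum_tri) (use assms tendsto_euler_fps[of "m * 2"] in \<open>simp_all add: power_mult\<close>)
  have lim2: "(\<lambda>N. qfac x (2 * N) * qfac x (2 * N) * euler_fps (m * 2))
      \<longlonglongrightarrow> euler_fps m * euler_fps m * euler_fps (m * 2)"
    unfolding x_def
    by (intro tendsto_mult_fps tendsto_const filterlim_compose[OF tendsto_euler_fps[OF assms]])
       (auto intro!: filterlim_subseq strict_monoI)
  have eq: "jsum (- x) (- (x ^ 1)) (\<lambda>_. fps_const 1) N N * euler_fps (m * Suc 1) * (qfac (x ^ 2) N * qfac (x ^ 2) N)
      = qfac x (2 * N) * qfac x (2 * N) * euler_fps (m * 2)" for N
    using j[of N] by (simp add: mult_ac power2_eq_square flip: mult_2)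
  from lim1[unfolded eq] lim2 have "theta (\<lambda>k. 1 * sg k) (tri_exp m 1) * (euler_fps (m * 2) * euler_fps (m * 2))
      = (euler_fps m * euler_fps m * euler_fps (m * 2) :: 'a fps)"
    by (rule LIMSEQ_unique)
  then show ?thesis by (simp add: power2_eq_square mult_ac)
qed

text \<open>At \<open>b = - 1\<close> the triple product vanishes through its factor
  \<open>1 + b\<close>, so the linear weight picks out the derivative. The factor 2 appears because
  the terms for \<open>k\<close> and \<open>- 1 - k\<close> coincide.\<close>

lemma jacobi_cube:
  assumes "m \<ge> 1"
  shows "theta (\<lambda>k. (2 * of_int k + 1) * sg k) (tri_exp m 0) = 2 * (euler_fps m ^ 3 :: 'a::field fps)"
proof -
  define x :: "'a fps" where "x = fps_X ^ m"
  define w :: "int \<Rightarrow> 'a fps" where "w = (\<lambda>k. fps_const (2 * of_int k + 1))"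
  have x0: "(- x * - 1) $ 0 = 0"
    using assms by (simp add: x_def fps_power_zeroth)
  \<comment> \<open>A shift changes the weight by a constant, so it adds a multiple of the
    unweighted sum, which vanishes as soon as \<open>n >= 1\<close>.\<close>
  have w: "(\<lambda>k. w (k + 1)) = (\<lambda>k. w k + 2)" "(\<lambda>k. w (k - 1)) = (\<lambda>k. w k - 2)"
    by (auto simp: w_def fun_eq_iff fps_eq_iff numeral_fps_const)
  have lin: "jsum (- x) (- 1) (\<lambda>k. w k + 2) m n = jsum (- x) (- 1) w m n + 2 * jsum (- x) (- 1) (\<lambda>_. 1) m n"
    "jsum (- x) (- 1) (\<lambda>k. w k - 2) m n = jsum (- x) (- 1) w m n - 2 * jsum (- x) (- 1) (\<lambda>_. 1) m n" for m n
    by (simp_all add: jsum_def algebra_simps sum.distrib sum_subtractf sum_distrib_left)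
  have z: "jsum (- x) (- 1) (\<lambda>_. 1) m (Suc n) = 0" for m n
    unfolding jacobi_triple_finite[OF x0] by (simp add: prod.lessThan_Suc_shift del: prod.lessThan_Suc)
  \<comment> \<open>Only the step from \<open>n = 0\<close> to \<open>n = 1\<close> meets a nonzero
    unweighted sum; it gives the starting value 2, and later steps just multiply by a
    factor.\<close>
  have j1: "jsum (- x) (- 1) w 0 (Suc n) = 2 * qfac x n" for n
  proof (induction n)
    case 0
    show ?case unfolding jsum_Suc_right[OF x0] w lin
      by (simp add: jsum_0_0[OF x0])
  next
    case (Suc n)
    then show ?case
      by (subst jsum_Suc_right[OF x0]) (simp add: w lin z algebra_simps)
  qed
  have j: "jsum (- x) (- 1) w m (Suc n) = 2 * qfac x m * qfac x n" for m n
  proof (induction m)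
    case (Suc m)
    then show ?case
      by (subst jsum_Suc_left[OF x0]) (simp add: w lin z algebra_simps)
  qed (simp add: j1)
  have lim: "(\<lambda>N. jsum (- x) (- 1) w N N * euler_fps m) \<longlonglongrightarrow> theta (\<lambda>k. (2 * of_int k + 1) * sg k) (tri_exp m 0)"
    using tendsto_jsum_tri[OF assms, of 0] by (simp add: x_def w_def)
  \<comment> \<open>The closed form \<open>j\<close> needs a positive second index, so the limit is
    taken along \<open>Suc N\<close>.\<close>
  then have "(\<lambda>N. jsum (- x) (- 1) w (Suc N) (Suc N) * euler_fps m) \<longlonglongrightarrow> theta (\<lambda>k. (2 * of_int k + 1) * sg k) (tri_exp m 0)"
    by (subst (asm) filterlim_sequentially_Suc[symmetric])
  moreover have "(\<lambda>N. 2 * qfac x (Suc N) * qfac x N * euler_fps m) \<longlonglongrightarrow> 2 * euler_fps m * euler_fps m * euler_fps m"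
    unfolding x_def
    by (intro tendsto_mult_fps tendsto_const tendsto_euler_fps assms
       filterlim_compose[OF tendsto_euler_fps[OF assms] filterlim_Suc])
  ultimately show ?thesis
    unfolding j power3_eq_cube mult.assoc by (rule LIMSEQ_unique)
qed

section \<open>A theta series for the square of the product\<close>

lemma sg_add: "sg (i + j) = sg i * sg j"
  by (auto simp: sg_def)

lemma of_int_sg [simp]: "of_int (sg k) = sg k"
  by (simp add: sg_def)

lemma tri_exp_1_1: "tri_exp 1 1 i = i\<^sup>2"
  using tri_add_tri[of i] by (simp add: tri_exp_def)

lemma tri_exp_4_0: "tri_exp 4 0 j = 2 * j\<^sup>2 + 2 * j"
  using int_tri[of j] by (simp add: tri_exp_def algebra_simps power2_eq_square)

lemma tri_exp_2: "2 * tri_exp m 2 k = int m * (3 * k\<^sup>2 - k)"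
proof -
  have "2 * tri_exp m 2 k = int m * (2 * int (tri k) + 2 * (2 * int (tri (k - 1))))"
    by (simp add: tri_exp_def algebra_simps)
  then show ?thesis
    unfolding int_tri by (simp add: algebra_simps power2_eq_square)
qed

text \<open>The symmetry \<open>i \<mapsto> -i\<close> lets us replace the weight \<open>2j + 1\<close> by \<open>i + 2j + 1\<close>. The new weight is
  fixed by a reflection of the form \<open>i\<^sup>2 + 2(j + 1/2)\<^sup>2\<close> that is integral on the class \<open>i - j \<equiv> 2\<close>
  modulo 3 and reverses the sign there, so that this class cancels; the other two classes contribute
  equally, and on \<open>i \<equiv> j\<close> the form splits as a sum in \<open>k\<close> and \<open>l\<close>.\<close>

lemma sum_pairs_quintuple:
  fixes n :: int
  shows "(\<Sum>(i, j) | i\<^sup>2 + (2 * j\<^sup>2 + 2 * j) = n. sg i * ((2 * j + 1) * sg j))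
    = 2 * (\<Sum>(k, l) | 3 * k\<^sup>2 + 2 * k + (6 * l\<^sup>2 - 2 * l) = n. (3 * k + 1) * sg l :: int)"
proof -
  define P where "P = {(i, j). i\<^sup>2 + (2 * j\<^sup>2 + 2 * j) = n}"
  define Q where "Q = {(k, l). 3 * k\<^sup>2 + 2 * k + (6 * l\<^sup>2 - 2 * l) = n}"
  define R where "R c = {(i, j). (i, j) \<in> P \<and> (i - j) mod 3 = c}" for c :: int
  define f where "f = (\<lambda>(i, j). sg (i + j) * (i + 2 * j + 1) :: int)"
  have "finite P"
  proof -
    have "finite {(i, j). tri_exp 1 1 i + tri_exp 4 0 j = n}"
      by (rule finite_fiber_pair) (auto intro: finite_tri_exp_fiber)
    then show ?thesis
      by (simp only: P_def tri_exp_1_1 tri_exp_4_0)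
  qed
  have "(\<Sum>(i, j)\<in>P. sg (i + j) * i) = (\<Sum>(i, j)\<in>P. - (sg (i + j) * i))"
    by (rule sum.reindex_bij_witness[of _ "\<lambda>(i, j). (- i, j)" "\<lambda>(i, j). (- i, j)"])
       (auto simp: P_def sg_def)
  then have "(\<Sum>(i, j)\<in>P. sg (i + j) * i) = 0"
    by (simp add: sum_negf case_prod_unfold)
  then have "(\<Sum>(i, j)\<in>P. sg i * ((2 * j + 1) * sg j)) = sum f P"
    by (simp add: f_def case_prod_unfold algebra_simps sum.distrib sg_add)
  also have "sum f P = sum f (R 0 \<union> R 1 \<union> R 2)"
  proof (rule sum.cong)
    show "P = R 0 \<union> R 1 \<union> R 2"
    proof -
      have "(i - j) mod 3 = 0 \<or> (i - j) mod 3 = 1 \<or> (i - j) mod 3 = 2" for i j :: int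
        by presburger
      then show ?thesis by (auto simp: R_def)
    qed
  qed simp
  also have "\<dots> = sum f (R 0) + sum f (R 1) + sum f (R 2)"
  proof -
    have "finite (R c)" for c
      by (rule finite_subset[OF _ \<open>finite P\<close>]) (auto simp: R_def)
    then show ?thesis
      by (subst sum.union_disjoint; (subst sum.union_disjoint)?) (auto simp: R_def)
  qed
  \<comment> \<open>The map \<open>(i, j) -> (- i, - 1 - j)\<close> negates both the sign and the
    weight \<open>i + 2 * j + 1\<close>, so it preserves \<open>f\<close>.\<close>
  also have "sum f (R 1) = sum f (R 0)"
  proof (rule sum.reindex_bij_witness[of _ "\<lambda>(i, j). (- i, - 1 - j)" "\<lambda>(i, j). (- i, - 1 - j)"])
    have P: "(- i, - 1 - j) \<in> P \<longleftrightarrow> (i, j) \<in> P" for i j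
      by (simp add: P_def power2_eq_square algebra_simps)
    have m3: "(- i - (- 1 - j)) mod 3 = 0 \<longleftrightarrow> (i - j) mod 3 = 1"
      "(- i - (- 1 - j)) mod 3 = 1 \<longleftrightarrow> (i - j) mod 3 = 0" for i j :: int
      by presburger+
    have R: "(i, j) \<in> R c \<longleftrightarrow> (i, j) \<in> P \<and> (i - j) mod 3 = c" for i j c
      by (simp add: R_def)
    show "x \<in> R 1 \<Longrightarrow> (case x of (i, j) \<Rightarrow> (- i, - 1 - j)) \<in> R 0"
      "x \<in> R 0 \<Longrightarrow> (case x of (i, j) \<Rightarrow> (- i, - 1 - j)) \<in> R 1" for x
      by (cases x; simp only: R P m3 prod.case)+
    show "f (case x of (i, j) \<Rightarrow> (- i, - 1 - j)) = f x" for x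
      by (auto simp: f_def sg_def split: prod.splits)
  qed auto
  also have "sum f (R 2) = 0"
  proof -
    \<comment> \<open>The reflection. It fixes \<open>i + 2 * j\<close>, and on \<open>R 2\<close>,
      where \<open>3 * t = 2 * (i - j) - 1\<close> exactly, it preserves the form; \<open>t\<close>
      is then odd, so the parity of \<open>i + j\<close> changes.\<close>
    define h where "h = (\<lambda>(i, j). let t = (2 * (i - j) - 1) div 3 in (i - 2 * t, j + t :: int))"
    have h_eq: "h (i, j) = (i - 2 * t, j + t)" if "2 * (i - j) - 1 = 3 * t" for i j t
      unfolding h_def Let_def prod.case that by simp
    have h: "h x \<in> R 2 \<and> h (h x) = x \<and> - f (h x) = f x" if "x \<in> R 2" for x
    proof -
      obtain i j where x: "x = (i, j)" by force
      with that have P: "(i, j) \<in> P" and m: "(i - j) mod 3 = 2" by (auto simp: R_def)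
      have "3 dvd 2 * (i - j) - 1"
        using m by presburger
      then obtain t where t: "2 * (i - j) - 1 = 3 * t"
        by (rule dvdE)
      have hx: "h x = (i - 2 * t, j + t)"
        unfolding x by (rule h_eq[OF t])
      have "(i - 2 * t)\<^sup>2 + (2 * (j + t)\<^sup>2 + 2 * (j + t))
        = i\<^sup>2 + (2 * j\<^sup>2 + 2 * j) + 2 * t * (3 * t - (2 * (i - j) - 1))"
        by (simp add: power2_eq_square algebra_simps)
      also have "\<dots> = i\<^sup>2 + (2 * j\<^sup>2 + 2 * j)"
        unfolding t by simp
      finally have "(i - 2 * t)\<^sup>2 + (2 * (j + t)\<^sup>2 + 2 * (j + t)) = i\<^sup>2 + (2 * j\<^sup>2 + 2 * j)" .
      with P have P': "(i - 2 * t, j + t) \<in> P"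
        unfolding P_def mem_Collect_eq prod.case by simp
      have d: "i - 2 * t - (j + t) = 1 - (i - j)"
        using t by presburger
      have t': "2 * (i - 2 * t - (j + t)) - 1 = 3 * (- t)"
        unfolding d using t by presburger
      then have hh: "h (h x) = x"
        by (subst hx, subst h_eq[OF t'], simp add: x)
      have "(1 - (i - j)) mod 3 = 2"
        using m by presburger
      then have hR: "h x \<in> R 2"
        unfolding hx R_def mem_Collect_eq prod.case d using P' by simp
      have "odd t"
        using t by presburger
      then have "- f (h x) = f x"
        unfolding hx unfolding x by (auto simp: f_def sg_def)
      with hR hh show ?thesis by simp
    qed
    have "sum f (R 2) = (\<Sum>x\<in>R 2. - f x)"
      by (rule sum.reindex_bij_witness[of _ h h]) (use h in auto)
    then show ?thesis by (simp add: sum_negf)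
  qed
  \<comment> \<open>Setting \<open>i = k + 2 * l\<close>, \<open>j = k - l\<close> turns the weight
    into \<open>3 * k + 1\<close> and leaves no mixed term in the form.\<close>
  also have "sum f (R 0) = (\<Sum>(k, l)\<in>Q. (3 * k + 1) * sg l)"
  proof (rule sum.reindex_bij_witness[of _ "\<lambda>(k, l). (k + 2 * l, k - l)"
        "\<lambda>(i, j). (j + (i - j) div 3, (i - j) div 3)"])
    fix x assume "x \<in> R 0"
    then obtain i j l where x: "x = (i, j)" "(i, j) \<in> P" "i = j + 3 * l"
      by (auto simp: R_def) (metis add_diff_cancel_left' diff_add_cancel dvdE mod_0_imp_dvd)
    then show "(case case x of (i, j) \<Rightarrow> (j + (i - j) div 3, (i - j) div 3) of (k, l) \<Rightarrow> (k + 2 * l, k - l)) = x"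
      "(case x of (i, j) \<Rightarrow> (j + (i - j) div 3, (i - j) div 3)) \<in> Q"
      "(case case x of (i, j) \<Rightarrow> (j + (i - j) div 3, (i - j) div 3) of (k, l) \<Rightarrow> (3 * k + 1) * sg l) = f x"
      by (auto simp: P_def Q_def f_def sg_def power2_eq_square algebra_simps)
  next
    fix x assume x: "x \<in> Q"
    obtain k l where kl: "x = (k, l)" by force
    have "(k + 2 * l - (k - l)) = 3 * l" by simp
    then show "(case case x of (k, l) \<Rightarrow> (k + 2 * l, k - l) of (i, j) \<Rightarrow> (j + (i - j) div 3, (i - j) div 3)) = x"
      "(case x of (k, l) \<Rightarrow> (k + 2 * l, k - l)) \<in> R 0"
      using x unfolding kl by (auto simp: P_def Q_def R_def power2_eq_square algebra_simps)
  qed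
  finally show ?thesis by (simp add: P_def Q_def)
qed

lemma quintuple_exp_bounds:
  fixes k :: int
  shows "\<bar>k\<bar> \<le> 3 * k\<^sup>2 + 2 * k + 1" "0 \<le> 3 * k\<^sup>2 + 2 * k"
proof -
  have "\<bar>k\<bar> * 1 \<le> \<bar>k\<bar> * \<bar>k\<bar>" if "k \<noteq> 0"
    using that by (intro mult_left_mono) auto
  then have "\<bar>k\<bar> \<le> k\<^sup>2"
    by (cases "k = 0") (simp_all add: power2_eq_square)
  then show "\<bar>k\<bar> \<le> 3 * k\<^sup>2 + 2 * k + 1" "0 \<le> 3 * k\<^sup>2 + 2 * k"
    by linarith+
qed

text \<open>Coefficientwise this is the integer identity for pairs, mapped by \<open>of_int\<close>;
  the exponent \<open>6 * l^2 - 2 * l\<close> gives the pentagonal series in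
  \<open>q^4\<close>.\<close>

lemma theta_quintuple:
  "theta sg (tri_exp 1 1) * theta (\<lambda>j. (2 * of_int j + 1) * sg j) (tri_exp 4 0)
    = (2 * (theta (\<lambda>k. 3 * of_int k + 1) (\<lambda>k. 3 * k\<^sup>2 + 2 * k) * theta sg (tri_exp 4 2)) :: 'a::comm_ring_1 fps)"
proof -
  note e = quintuple_exp_bounds
  have e4: "tri_exp 4 2 l = 6 * l\<^sup>2 - 2 * l" for l
    using tri_exp_2[of 4 l] by simp
  have "theta sg (tri_exp 1 1) * theta (\<lambda>j. (2 * of_int j + 1) * sg j) (tri_exp 4 0)
    = (theta (\<lambda>(i, j). sg i * ((2 * of_int j + 1) * sg j)) (\<lambda>(i, j). tri_exp 1 1 i + tri_exp 4 0 j) :: 'a fps)"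
    by (rule theta_mult) (auto intro: finite_tri_exp_fiber)
  also have "\<dots> = 2 * theta (\<lambda>(k, l). (3 * of_int k + 1) * sg l) (\<lambda>(k, l). 3 * k\<^sup>2 + 2 * k + tri_exp 4 2 l)"
    unfolding fps_eq_iff
  proof
    fix n
    from sum_pairs_quintuple[of "int n", THEN arg_cong, of "of_int :: int \<Rightarrow> 'a"]
    show "(theta (\<lambda>(i, j). sg i * ((2 * of_int j + 1) * sg j)) (\<lambda>(i, j). tri_exp 1 1 i + tri_exp 4 0 j) :: 'a fps) $ n
      = (2 * theta (\<lambda>(k, l). (3 * of_int k + 1) * sg l) (\<lambda>(k, l). 3 * k\<^sup>2 + 2 * k + tri_exp 4 2 l)) $ n"
      by (simp add: theta_def tri_exp_1_1[unfolded One_nat_def] tri_exp_4_0 e4 case_prod_unfold numeral_fps_const)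
  qed
  also have "theta (\<lambda>(k, l). (3 * of_int k + 1) * sg l) (\<lambda>(k, l). 3 * k\<^sup>2 + 2 * k + tri_exp 4 2 l)
    = (theta (\<lambda>k. 3 * of_int k + 1) (\<lambda>k. 3 * k\<^sup>2 + 2 * k) * theta sg (tri_exp 4 2) :: 'a fps)"
    by (rule theta_mult[symmetric]) (use e in \<open>auto intro: finite_tri_exp_fiber finite_theta_fiber\<close>)
  finally show ?thesis .
qed

text \<open>Let \<open>phi\<close> be the theta series of the squares. Jacobi's and Euler's
  identities turn \<open>theta_quintuple\<close> into \<open>phi * E_4^2 = Q\<close> after
  cancelling \<open>2 * E_4\<close>. Gauss's identity \<open>E_1^2 = phi * E_2\<close> leaves the
  pentagonal series for \<open>E_2\<close>.\<close>

lemma euler_square_product: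
  "(euler_fps 1 * euler_fps 4) ^ 2
    = (theta (\<lambda>k. 3 * of_int k + 1) (\<lambda>k. 3 * k\<^sup>2 + 2 * k) * theta sg (tri_exp 2 2) :: 'a::field_char_0 fps)"
    (is "_ = ?Q * _")
proof -
  let ?\<phi> = "theta sg (tri_exp 1 1) :: 'a fps"
  have "?\<phi> * (2 * euler_fps 4 ^ 3) = 2 * (?Q * euler_fps 4)"
    using theta_quintuple[where ?'a = 'a] jacobi_cube[of 4, where ?'a = 'a] euler_pentagonal[of 4, where ?'a = 'a]
    by simp
  then have "(2 * euler_fps 4) * (?\<phi> * euler_fps 4 ^ 2) = (2 * euler_fps 4) * ?Q"
    by (simp add: power2_eq_square power3_eq_cube mult_ac)
  then have Q: "?\<phi> * euler_fps 4 ^ 2 = ?Q"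
    by (subst (asm) mult_cancel_left) simp
  have "(euler_fps 1 * euler_fps 4) ^ 2 = ?\<phi> * euler_fps 2 * euler_fps 4 ^ 2"
    using gauss_square[of 1, where ?'a = 'a] by (simp add: power_mult_distrib)
  also have "\<dots> = ?Q * theta sg (tri_exp 2 2)"
    unfolding Q[symmetric] using euler_pentagonal[of 2, where ?'a = 'a] by (simp add: mult_ac)
  finally show ?thesis .
qed

section \<open>Divisibility of the coefficients\<close>

text \<open>If \<open>l\<close> did not divide \<open>x\<close>, raising \<open>x^2 = - y^2\<close>
  to the odd power \<open>(l - 1) / 2\<close> and applying Fermat's theorem would give
  \<open>1 = - 1\<close> modulo \<open>l\<close>.\<close>

lemma prime_3_mod_4_dvd_sum_squares:
  fixes x y :: int
  assumes p: "prime l" and l: "[l = 3] (mod 4)" and dvd: "int l dvd x\<^sup>2 + y\<^sup>2"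
  shows "int l dvd x"
proof (rule ccontr)
  assume x: "\<not> int l dvd x"
  have "prime (int l)" using p by simp
  have y: "\<not> int l dvd y"
  proof
    assume "int l dvd y"
    with dvd have "int l dvd x\<^sup>2"
      by (simp add: dvd_add_left_iff power2_eq_square)
    with x show False
      using \<open>prime (int l)\<close> by (simp add: prime_dvd_power_iff)
  qed
  define n where "n = 2 * (l div 4) + 1"
  have "l mod 4 = 3"
    using l by (simp add: unique_euclidean_semiring_class.cong_def)
  then have n: "l - 1 = 2 * n" "odd n"
    unfolding n_def using div_mult_mod_eq[of l 4] by simp_all
  have fermat: "[z ^ (2 * n) = 1] (mod int l)" if "\<not> int l dvd z" for z
  proof -
    have "[nat \<bar>z\<bar> ^ (l - 1) = 1] (mod l)"
      using that by (intro fermat_theorem p) (simp add: int_dvd_int_iff[symmetric])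
    then have "[int (nat \<bar>z\<bar> ^ (l - 1)) = int 1] (mod int l)"
      by (simp only: cong_int_iff)
    then show ?thesis
      unfolding n(1) by (simp add: power_even_abs)
  qed
  have "[x\<^sup>2 = - (y\<^sup>2)] (mod int l)"
    using dvd by (simp add: cong_iff_dvd_diff)
  then have "[(x\<^sup>2) ^ n = (- (y\<^sup>2)) ^ n] (mod int l)"
    by (rule cong_pow)
  then have "[x ^ (2 * n) = - (y ^ (2 * n))] (mod int l)"
    using n(2) by (simp add: power_mult)
  then have "[1 = - 1] (mod int l)"
    using fermat[OF x] fermat[OF y] by (metis cong_minus_minus_iff cong_sym cong_trans)
  then have "int l dvd int 2"
    by (simp add: cong_iff_dvd_diff)
  then have "l dvd 2"
    by (simp only: int_dvd_int_iff)
  then have "l \<le> 2" by (rule dvd_imp_le) simp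
  with prime_gt_1_nat[OF p] have "l = 2" by simp
  with l show False by (simp add: unique_euclidean_semiring_class.cong_def)
qed

text \<open>Divisibility says nothing in a field, so the weights are integers and the coefficient is
  exhibited as the image of a multiple of \<open>c\<close>.\<close>

lemma theta_mult_nth_dvd:
  fixes w w' :: "int \<Rightarrow> int"
  assumes "\<And>i. 0 \<le> e i" "\<And>i. \<bar>i\<bar> \<le> e i + 1" "\<And>j. 0 \<le> e' j" "\<And>j. \<bar>j\<bar> \<le> e' j + 1"
    and dvd: "\<And>i j. e i + e' j = int N \<Longrightarrow> c dvd w i * w' j"
  shows "\<exists>u. (theta (\<lambda>i. of_int (w i)) e * theta (\<lambda>j. of_int (w' j)) e') $ N = of_int (c * u)"
proof -
  have nth: "(theta (\<lambda>i. of_int (w i)) e * theta (\<lambda>j. of_int (w' j)) e') $ N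
    = of_int (\<Sum>(i, j) | e i + e' j = int N. w i * w' j)"
    using assms(1-4)
    by (subst theta_mult) (auto simp: theta_def case_prod_unfold intro: finite_theta_fiber)
  have "c dvd (\<Sum>(i, j) | e i + e' j = int N. w i * w' j)"
    using dvd by (intro dvd_sum) auto
  then obtain u where u: "(\<Sum>(i, j) | e i + e' j = int N. w i * w' j) = c * u"
    by (rule dvdE)
  show ?thesis
    unfolding nth u by blast
qed

lemma euler_square_nth_dvd:
  assumes p: "prime l" and l: "[l = 3] (mod 4)" and N: "int l dvd 12 * int N + 5"
  shows "\<exists>u. ((euler_fps 1 * euler_fps 4) ^ 2) $ N = (of_int (int l * u) :: 'a::field_char_0)"
proof -
  have *: "int l dvd 3 * k + 1" if "3 * k\<^sup>2 + 2 * k + tri_exp 2 2 j = int N" for k j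
  proof -
    have eq: "12 * int N + 5 = (2 * (3 * k + 1))\<^sup>2 + (6 * j - 1)\<^sup>2"
      unfolding that[symmetric] using tri_exp_2[of 2 j]
      by (simp add: power2_eq_square algebra_simps)
    have "int l dvd 2 * (3 * k + 1)"
      by (rule prime_3_mod_4_dvd_sum_squares[OF p l N[unfolded eq]])
    moreover have "coprime (int l) 2"
      using l unfolding unique_euclidean_semiring_class.cong_def coprime_right_2_iff_odd even_of_nat
      by presburger
    ultimately show ?thesis
      by (simp only: coprime_dvd_mult_right_iff)
  qed
  note e = quintuple_exp_bounds
  have "\<exists>u. (theta (\<lambda>k. of_int (3 * k + 1)) (\<lambda>k. 3 * k\<^sup>2 + 2 * k)
      * theta (\<lambda>k. of_int (sg k)) (tri_exp 2 2)) $ N = (of_int (int l * u) :: 'a)"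
    by (rule theta_mult_nth_dvd) (use e * tri_exp_ge in auto)
  then show ?thesis
    unfolding euler_square_product by simp
qed

text \<open>The factor 4 comes from the factors 2 in Jacobi's identity, used once for
  \<open>E_1^3\<close> and once for \<open>E_4^3\<close>.\<close>

lemma euler_cube_nth_dvd:
  assumes p: "prime l" and l: "[l = 3] (mod 4)" and N: "int l dvd 8 * int N + 5"
  shows "\<exists>u. 4 * ((euler_fps 1 * euler_fps 4) ^ 3) $ N = (of_int (int l * u) :: 'a::field)"
proof -
  have *: "int l dvd 2 * i + 1" if "tri_exp 1 0 i + tri_exp 4 0 j = int N" for i j
  proof -
    have "2 * tri_exp 1 0 i = i * (i + 1)"
      using int_tri[of i] by (simp add: tri_exp_def)
    then have eq: "8 * int N + 5 = (2 * i + 1)\<^sup>2 + (2 * (2 * j + 1))\<^sup>2"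
      unfolding that[symmetric] tri_exp_4_0
      by (simp add: power2_eq_square algebra_simps)
    show ?thesis
      by (rule prime_3_mod_4_dvd_sum_squares[OF p l N[unfolded eq]])
  qed
  have "\<exists>u. (theta (\<lambda>k. of_int ((2 * k + 1) * sg k)) (tri_exp 1 0)
      * theta (\<lambda>k. of_int ((2 * k + 1) * sg k)) (tri_exp 4 0)) $ N = (of_int (int l * u) :: 'a)"
    by (rule theta_mult_nth_dvd) (use * tri_exp_ge in auto)
  moreover have "theta (\<lambda>k. of_int ((2 * k + 1) * sg k)) (tri_exp 1 0)
      * theta (\<lambda>k. of_int ((2 * k + 1) * sg k)) (tri_exp 4 0)
    = (fps_const 4 * (euler_fps 1 * euler_fps 4) ^ 3 :: 'a fps)"
    using jacobi_cube[of 1, where ?'a = 'a] jacobi_cube[of 4, where ?'a = 'a]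
    by (simp add: power_mult_distrib numeral_fps_const[symmetric] mult_ac)
  ultimately show ?thesis by simp
qed

section \<open>Power series over the localization at a prime\<close>

definition zloc :: "nat \<Rightarrow> rat set" where
  "zloc l = {x. \<exists>u v. x = of_int u / of_int v \<and> \<not> int l dvd v}"

locale prime_localization =
  fixes l :: nat
  assumes prime_l: "prime l"
begin

lemma zlocI: "\<not> int l dvd v \<Longrightarrow> of_int u / of_int v \<in> zloc l"
  by (auto simp: zloc_def)

lemma not_dvd_mult: "\<not> int l dvd u \<Longrightarrow> \<not> int l dvd v \<Longrightarrow> \<not> int l dvd u * v"
  using prime_l by (simp add: prime_dvd_mult_iff)

lemma of_int_zloc [simp]: "of_int u \<in> zloc l"
proof -
  have "\<not> int l dvd 1"
    using prime_gt_1_nat[OF prime_l] by simp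
  from zlocI[OF this, of u] show ?thesis by simp
qed

lemma zloc_0 [simp]: "0 \<in> zloc l" and zloc_1 [simp]: "1 \<in> zloc l"
  using of_int_zloc[of 0] of_int_zloc[of 1] by simp_all

lemma of_nat_zloc [simp]: "of_nat u \<in> zloc l"
  using of_int_zloc[of "int u"] by simp

lemma inverse_of_int_zloc: "\<not> int l dvd v \<Longrightarrow> inverse (of_int v) \<in> zloc l"
  using zlocI[of v 1] by (simp add: divide_inverse)

lemma add_zloc [simp]:
  assumes "x \<in> zloc l" "y \<in> zloc l"
  shows "x + y \<in> zloc l"
proof -
  obtain u v u' v' where *: "x = of_int u / of_int v" "\<not> int l dvd v"
    "y = of_int u' / of_int v'" "\<not> int l dvd v'"
    using assms by (auto simp: zloc_def)
  then have "v \<noteq> 0" "v' \<noteq> 0" by auto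
  then have "x + y = of_int (u * v' + u' * v) / of_int (v * v')"
    by (simp add: * field_simps)
  then show ?thesis
    using zlocI[OF not_dvd_mult] * by metis
qed

lemma mult_zloc [simp]:
  assumes "x \<in> zloc l" "y \<in> zloc l"
  shows "x * y \<in> zloc l"
proof -
  obtain u v u' v' where *: "x = of_int u / of_int v" "\<not> int l dvd v"
    "y = of_int u' / of_int v'" "\<not> int l dvd v'"
    using assms by (auto simp: zloc_def)
  then have "x * y = of_int (u * u') / of_int (v * v')"
    by simp
  then show ?thesis
    using zlocI[OF not_dvd_mult] * by metis
qed

lemma uminus_zloc [simp]: "x \<in> zloc l \<Longrightarrow> - x \<in> zloc l"
  using mult_zloc[of "- 1" x] of_int_zloc[of "- 1"] by simp

lemma diff_zloc [simp]: "x \<in> zloc l \<Longrightarrow> y \<in> zloc l \<Longrightarrow> x - y \<in> zloc l"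
  using add_zloc[of x "- y"] by simp

lemma sum_zloc: "(\<And>i. i \<in> A \<Longrightarrow> f i \<in> zloc l) \<Longrightarrow> sum f A \<in> zloc l"
  by (induction A rule: infinite_finite_induct) auto

text \<open>Cross multiplication with the reduced fraction; \<open>l\<close> is prime and does not
  divide the denominator of \<open>y\<close>.\<close>

lemma rat_cong_zeroI:
  assumes "x = of_nat l * y" "y \<in> zloc l"
  shows "rat_cong_zero x (int l)"
proof -
  obtain u v where y: "y = of_int u / of_int v" "\<not> int l dvd v"
    using assms(2) by (auto simp: zloc_def)
  obtain p q where pq: "quotient_of x = (p, q)" by force
  have "q > 0" "v \<noteq> 0" using quotient_of_denom_pos[OF pq] y by auto
  have "(of_int (p * v) :: rat) = of_int (int l * u * q)"
    using quotient_of_div[OF pq] \<open>q > 0\<close> \<open>v \<noteq> 0\<close> by (simp add: assms(1) y(1) field_simps)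
  then have "p * v = int l * u * q"
    by (simp only: of_int_eq_iff)
  then have "int l dvd p * v" by (simp add: mult.assoc)
  then have "int l dvd p"
    using y(2) prime_l by (simp add: prime_dvd_mult_iff)
  then show ?thesis by (simp add: rat_cong_zero_def pq)
qed

section \<open>Power series with coefficients in the localization\<close>

definition fps_zloc :: "rat fps set" where
  "fps_zloc = {A. \<forall>n. A $ n \<in> zloc l}"

lemma fps_zlocI: "(\<And>n. A $ n \<in> zloc l) \<Longrightarrow> A \<in> fps_zloc"
  and fps_zlocD: "A \<in> fps_zloc \<Longrightarrow> A $ n \<in> zloc l"
  by (simp_all add: fps_zloc_def)

lemma fps_zloc_1 [simp]: "1 \<in> fps_zloc"
  by (simp add: fps_zloc_def)

lemma fps_zloc_mult [simp]: "A \<in> fps_zloc \<Longrightarrow> B \<in> fps_zloc \<Longrightarrow> A * B \<in> fps_zloc"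
  by (auto simp: fps_zloc_def fps_mult_nth intro!: sum_zloc)

lemma fps_zloc_diff [simp]: "A \<in> fps_zloc \<Longrightarrow> B \<in> fps_zloc \<Longrightarrow> A - B \<in> fps_zloc"
  by (auto simp: fps_zloc_def)

lemma fps_zloc_power [simp]: "A \<in> fps_zloc \<Longrightarrow> A ^ n \<in> fps_zloc"
  by (induction n) auto

lemma fps_zloc_deriv [simp]: "A \<in> fps_zloc \<Longrightarrow> fps_deriv A \<in> fps_zloc"
  using of_nat_zloc[of "Suc n" for n] by (auto simp: fps_zloc_def simp del: of_nat_Suc)

lemma fps_zloc_cutoff: "(\<And>i. i < n \<Longrightarrow> A $ i \<in> zloc l) \<Longrightarrow> fps_cutoff n A \<in> fps_zloc"
  by (auto simp: fps_zloc_def)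

lemma fps_zloc_X [simp]: "fps_X \<in> fps_zloc"
  by (auto simp: fps_zloc_def fps_X_def)

lemma qfac_fps_zloc [simp]: "q \<in> fps_zloc \<Longrightarrow> qfac q n \<in> fps_zloc"
  by (induction n) (auto simp del: power_Suc)

lemma euler_fps_zloc [simp]: "euler_fps m \<in> fps_zloc"
  by (rule fps_zlocI) (simp add: euler_fps_def fps_zlocD)

text \<open>The coefficients of \<open>B\<close> follow recursively from those of
  \<open>A * B\<close>, dividing only by \<open>A $ 0\<close>.\<close>

lemma fps_zloc_cancel:
  assumes A: "A \<in> fps_zloc" "A $ 0 \<noteq> 0" "inverse (A $ 0) \<in> zloc l" and AB: "A * B \<in> fps_zloc"
  shows "B \<in> fps_zloc"
proof (rule fps_zlocI)
  show "B $ n \<in> zloc l" for n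
  proof (induction n rule: less_induct)
    case (less n)
    have "(A * B) $ n = A $ 0 * B $ n + (\<Sum>i=1..n. A $ i * B $ (n - i))"
      by (simp add: fps_mult_nth sum.atLeast_Suc_atMost)
    then have "B $ n = inverse (A $ 0) * ((A * B) $ n - (\<Sum>i=1..n. A $ i * B $ (n - i)))"
      using A(2) by simp
    also have "\<dots> \<in> zloc l"
      using A AB less by (intro mult_zloc diff_zloc sum_zloc) (auto simp: fps_zlocD)
    finally show ?case .
  qed
qed

text \<open>Induction on the coefficient: if \<open>A\<close> is \<open>K\<close> truncated below
  degree \<open>n > 0\<close>, the \<open>n\<close>-th coefficient of \<open>K^b - A^b\<close> is
  \<open>b\<close> times that of \<open>K\<close>, and \<open>b\<close> is a unit.\<close>

lemma fps_zloc_root: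
  assumes Kb: "K ^ b \<in> fps_zloc" and K0: "K $ 0 = 1" and b: "\<not> l dvd b"
  shows "K \<in> fps_zloc"
proof (rule fps_zlocI)
  show "K $ n \<in> zloc l" for n
  proof (induction n rule: less_induct)
    case (less n)
    show ?case
    proof (cases "n = 0")
      case False
      define A where "A = fps_cutoff n K"
      define S where "S = (\<Sum>i<b. A ^ (b - Suc i) * K ^ i)"
      have "A \<in> fps_zloc"
        unfolding A_def using less by (rule fps_zloc_cutoff)
      have "A $ 0 = 1"
        using False by (simp add: A_def K0)
      then have S0: "S $ 0 = of_nat b"
        by (simp add: S_def fps_sum_nth fps_power_zeroth K0)
      \<comment> \<open>\<open>K - A\<close> starts in degree \<open>n\<close>, so only the constant
        term of \<open>S\<close> enters, to which each of the \<open>b\<close> summands contributes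
        1.\<close>
      have "(K ^ b - A ^ b) $ n = ((K - A) * S) $ n"
        unfolding S_def power_diff_sumr2 ..
      also have "\<dots> = (\<Sum>i=0..n. if i = n then K $ n * of_nat b else 0)"
        unfolding fps_mult_nth by (intro sum.cong) (auto simp: A_def S0)
      also have "\<dots> = K $ n * of_nat b" by simp
      finally have "K $ n = inverse (of_int (int b)) * (K ^ b - A ^ b) $ n"
        using b by (cases "b = 0") auto
      also have "\<dots> \<in> zloc l"
        using Kb \<open>A \<in> fps_zloc\<close> b by (intro mult_zloc inverse_of_int_zloc fps_zlocD fps_zloc_diff) auto
      finally show ?thesis .
    qed (simp add: K0)
  qed
qed

text \<open>\<open>H\<close> stands for \<open>(V / U)^(l / b)\<close>. Cancelling
  \<open>U^l\<close> and extracting a \<open>b\<close>-th root gives integrality. Since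
  \<open>l\<close> divides the derivative, it divides \<open>n * H $ n\<close>, and \<open>n\<close>
  can be removed when it is a unit.\<close>

lemma root_of_frobenius:
  assumes eq: "H ^ b * U ^ l = V ^ l" and H0: "H $ 0 = 1" and b: "\<not> l dvd b"
    and U: "U \<in> fps_zloc" "U $ 0 = 1" and V: "V \<in> fps_zloc"
  shows "H \<in> fps_zloc" and "\<And>n. \<not> l dvd n \<Longrightarrow> H $ n / of_nat l \<in> zloc l"
proof -
  have l0: "l > 0" using prime_l by (rule prime_gt_0_nat)
  have "b \<noteq> 0" using b by (metis dvd_0_right)
  have "H ^ b \<in> fps_zloc"
  proof (rule fps_zloc_cancel[of "U ^ l"])
    show "U ^ l * H ^ b \<in> fps_zloc"
      using eq V by (simp add: mult.commute)
  qed (use U in \<open>simp_all add: fps_power_zeroth\<close>)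
  then show H: "H \<in> fps_zloc"
    by (rule fps_zloc_root[OF _ H0 b])
  \<comment> \<open>Differentiating \<open>H\<^sup>b U\<^sup>l = V\<^sup>l\<close> produces a factor \<open>l\<close> on both \<open>U'\<close> and \<open>V'\<close>, hence on \<open>H'\<close>.\<close>
  define D where "D = fps_const (inverse (of_nat l)) * fps_deriv H"
  define A where "A = of_nat b * H ^ (b - 1) * U ^ l"
  have nz: "of_nat b \<in> fps_zloc" for b
    by (rule fps_zlocI) (simp add: fps_of_nat[symmetric])
  have one: "fps_const (inverse (of_nat l)) * of_nat l = (1 :: rat fps)"
    using l0 by (simp add: fps_of_nat[symmetric])
  have "of_nat b * fps_deriv H * H ^ (b - 1) * U ^ l + H ^ b * (of_nat l * fps_deriv U * U ^ (l - 1))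
      = of_nat l * fps_deriv V * V ^ (l - 1)"
    unfolding fps_deriv_power'[symmetric] eq[symmetric] by simp
  then have AH: "A * fps_deriv H = of_nat l * (fps_deriv V * V ^ (l - 1) - H ^ b * fps_deriv U * U ^ (l - 1))"
    unfolding A_def right_diff_distrib by (simp only: mult_ac eq_diff_eq)
  have "A * D = fps_const (inverse (of_nat l)) * (A * fps_deriv H)"
    by (simp only: D_def mult.left_commute)
  also have "\<dots> = fps_deriv V * V ^ (l - 1) - H ^ b * fps_deriv U * U ^ (l - 1)"
    unfolding AH mult.assoc[symmetric, of "fps_const _"] one by simp
  finally have AD: "A * D \<in> fps_zloc"
    using H U V by simp
  have "D \<in> fps_zloc"
  proof (rule fps_zloc_cancel[OF _ _ _ AD])
    show "A \<in> fps_zloc" using H U nz by (simp add: A_def)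
    have A0: "A $ 0 = of_int (int b)"
      using H0 U by (simp add: A_def fps_power_zeroth fps_of_nat[symmetric])
    show "A $ 0 \<noteq> 0" using A0 \<open>b \<noteq> 0\<close> by simp
    show "inverse (A $ 0) \<in> zloc l"
      unfolding A0 using b by (intro inverse_of_int_zloc) simp
  qed
  show "H $ n / of_nat l \<in> zloc l" if n: "\<not> l dvd n" for n
  proof (cases n)
    case (Suc k)
    have "H $ n / of_nat l = inverse (of_int (int n)) * D $ k"
      by (simp add: D_def Suc field_simps del: of_nat_Suc)
    also have "\<dots> \<in> zloc l"
      using n \<open>D \<in> fps_zloc\<close> by (intro mult_zloc inverse_of_int_zloc fps_zlocD) auto
    finally show ?thesis .
  qed (use n in simp)
qed

end

section \<open>Binomial powers and the congruence\<close>

lemma fps_gpow_add: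
  assumes "F $ 0 = 1"
  shows "fps_gpow F (s + t) = fps_gpow F s * fps_gpow F t"
  using assms by (simp add: fps_gpow_def fps_binomial_add_mult fps_compose_mult_distrib)

lemma fps_gpow_of_nat:
  assumes "F $ 0 = 1"
  shows "fps_gpow F (of_nat n) = F ^ n"
  by (induction n) (use assms in \<open>simp_all add: fps_gpow_add fps_gpow_1\<close>, simp add: fps_gpow_def)

lemma fps_gpow_power:
  assumes "F $ 0 = 1"
  shows "fps_gpow F t ^ n = fps_gpow F (t * of_nat n)"
  by (induction n) (use assms in \<open>simp_all add: fps_gpow_add algebra_simps\<close>, simp add: fps_gpow_def)

lemma tendsto_power_fps:
  fixes A :: "'a::comm_ring_1 fps"
  assumes "(f \<longlongrightarrow> A) F"
  shows "((\<lambda>x. f x ^ n) \<longlongrightarrow> A ^ n) F"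
  by (induction n) (use assms in \<open>auto intro: tendsto_mult_fps\<close>)

text \<open>For \<open>b > 0\<close> the hypothesis says \<open>t = (n2 - n1) / b\<close>; two
  natural exponents avoid negative powers. The identity holds for each factor, hence for partial
  products and in the limit.\<close>

lemma p_1m_power:
  fixes t :: rat
  assumes m: "m \<ge> 1" and t: "t * of_nat b + of_nat n1 = of_nat n2"
  shows "Abs_fps (p_1m m t) ^ b * (euler_fps 1 * euler_fps m) ^ n1 = (euler_fps 1 * euler_fps m) ^ n2"
proof -
  define P where "P N = (\<Prod>j\<le>N. fps_gpow (factor_1m m (Suc j)) t)" for N
  define R :: "nat \<Rightarrow> rat fps"
    where "R N = qfac (fps_X ^ 1) (Suc N) * qfac (fps_X ^ m) (Suc N)" for N
  have P: "P \<longlonglongrightarrow> Abs_fps (p_1m m t)"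
    unfolding P_def by (rule has_prod_imp_tendsto) (rule p_1m_has_prod[OF m])
  have R: "R \<longlonglongrightarrow> euler_fps 1 * euler_fps m"
    unfolding R_def
    by (intro tendsto_mult_fps filterlim_compose[OF tendsto_euler_fps filterlim_Suc] m) simp
  have "R N = (\<Prod>j\<le>N. factor_1m m (Suc j))" for N
    unfolding R_def qfac_def lessThan_Suc_atMost prod.distrib[symmetric]
    by (simp only: factor_1m_def power_mult power_one_right)
  moreover have "(\<Prod>j\<le>N. fps_gpow (factor_1m m (Suc j)) t) ^ b * (\<Prod>j\<le>N. factor_1m m (Suc j)) ^ n1
      = (\<Prod>j\<le>N. factor_1m m (Suc j)) ^ n2" for N
    unfolding prod_power_distrib prod.distrib[symmetric]
  proof (rule prod.cong[OF refl])
    fix j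
    have f0: "factor_1m m (Suc j) $ 0 = 1"
      using m by (simp add: factor_1m_def fps_power_zeroth)
    show "fps_gpow (factor_1m m (Suc j)) t ^ b * factor_1m m (Suc j) ^ n1 = factor_1m m (Suc j) ^ n2"
      unfolding fps_gpow_power[OF f0] fps_gpow_of_nat[OF f0, symmetric] fps_gpow_add[OF f0, symmetric] t ..
  qed
  ultimately have eq: "P N ^ b * R N ^ n1 = R N ^ n2" for N
    by (simp add: P_def)
  have "(\<lambda>N. P N ^ b * R N ^ n1) \<longlonglongrightarrow> Abs_fps (p_1m m t) ^ b * (euler_fps 1 * euler_fps m) ^ n1"
    by (intro tendsto_mult_fps tendsto_power_fps P R)
  moreover have "(\<lambda>N. R N ^ n2) \<longlonglongrightarrow> (euler_fps 1 * euler_fps m) ^ n2"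
    by (intro tendsto_power_fps R)
  ultimately show ?thesis
    unfolding eq by (rule LIMSEQ_unique)
qed

lemma p_1m_0:
  assumes "m \<ge> 1"
  shows "p_1m m t 0 = 1"
proof -
  have "(\<lambda>N. \<Prod>j\<le>N. fps_gpow (factor_1m m (Suc j)) t) \<longlonglongrightarrow> Abs_fps (p_1m m t)"
    by (rule has_prod_imp_tendsto) (rule p_1m_has_prod[OF assms])
  then have "\<forall>\<^sub>F N in sequentially. (\<Prod>j\<le>N. fps_gpow (factor_1m m (Suc j)) t) $ 0 = p_1m m t 0"
    by (simp add: tendsto_fps_iff)
  moreover have "(\<Prod>j\<le>N. fps_gpow (factor_1m m (Suc j)) t) $ 0 = 1" for N
    by (induction N) simp_all
  ultimately show ?thesis by simp
qed

context prime_localization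
begin

text \<open>Put \<open>H = F / E^d\<close> and \<open>a + d * b = l * s\<close>. Then
  \<open>F^b = E^(-a)\<close> becomes \<open>H^b = E^(- l * s)\<close>, an \<open>l\<close>-th
  power, and \<open>root_of_frobenius\<close> applies.\<close>

lemma p_1m_factorization:
  assumes m: "m \<ge> 1" and b: "b \<ge> 1" "\<not> int l dvd b" and dvd: "int l dvd a + int d * b"
  obtains H where "Abs_fps (p_1m m (- of_int a / of_int b)) = (euler_fps 1 * euler_fps m) ^ d * H"
    "\<And>n. \<not> l dvd n \<Longrightarrow> H $ n / of_nat l \<in> zloc l" "H \<in> fps_zloc"
proof -
  define t :: rat where "t = - of_int a / of_int b"
  define E :: "rat fps" where "E = euler_fps 1 * euler_fps m"
  define F where "F = Abs_fps (p_1m m t)"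
  define H where "H = F * inverse (E ^ d)"
  define B where "B = nat b"
  have B: "b = int B" using b by (simp add: B_def)
  obtain s where s: "a + int d * b = int l * s"
    using dvd by (rule dvdE)
  have E0: "E $ 0 = 1" by (simp add: E_def)
  have F: "F = E ^ d * H"
    by (simp add: H_def mult.left_commute[of "E ^ d"] inverse_mult_eq_1' fps_power_zeroth E0)
  \<comment> \<open>The sign of \<open>s\<close> is unknown, so its positive and negative parts go
    to opposite sides.\<close>
  define n1 where "n1 = l * nat s"
  define n2 where "n2 = l * nat (- s) + d * B"
  have "- a + int n1 = int n2"
    using s unfolding n1_def n2_def B by (cases "s \<ge> 0") (auto simp: algebra_simps)
  then have "- of_int a + of_nat n1 = (of_nat n2 :: rat)"
    by (metis of_int_add of_int_minus of_int_of_nat_eq)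
  then have "t * of_nat B + of_nat n1 = of_nat n2"
    using b by (simp add: t_def B)
  from p_1m_power[OF m this] have "F ^ B * E ^ n1 = E ^ n2"
    by (simp only: F_def E_def)
  then have "E ^ (d * B) * (H ^ B * (E ^ nat s) ^ l) = E ^ (d * B) * (E ^ nat (- s)) ^ l"
    unfolding F n1_def n2_def by (simp add: power_mult_distrib power_add mult_ac flip: power_mult)
  moreover have "E ^ (d * B) \<noteq> 0"
    using E0 by auto
  ultimately have eq: "H ^ B * (E ^ nat s) ^ l = (E ^ nat (- s)) ^ l"
    by (metis mult_cancel_left)
  have H0: "H $ 0 = 1"
    using p_1m_0[OF m] by (simp add: H_def F_def fps_power_zeroth E0)
  have E: "E \<in> fps_zloc" by (simp add: E_def)
  have "\<not> l dvd B" using b(2) by (simp add: B)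
  note root = root_of_frobenius[OF eq H0 this fps_zloc_power[OF E] _ fps_zloc_power[OF E]]
  show thesis
  proof
    show "Abs_fps (p_1m m (- of_int a / of_int b)) = (euler_fps 1 * euler_fps m) ^ d * H"
      using F by (simp only: F_def t_def E_def)
  qed (rule root; simp add: fps_power_zeroth E0)+
qed

text \<open>In the convolution at \<open>l * n + r\<close>, either \<open>i\<close> is congruent to
  \<open>r\<close> and \<open>l\<close> divides the coefficient of \<open>E\<close>, or
  \<open>l\<close> does not divide \<open>l * n + r - i\<close> and it divides that of
  \<open>H\<close>.\<close>

lemma rat_cong_zero_p_1m:
  assumes m: "m \<ge> 1" and b: "b \<ge> 1" "\<not> int l dvd b" and dvd: "int l dvd a + int d * b"
    and coeff: "\<And>N. [N = r] (mod l) \<Longrightarrow> ((euler_fps 1 * euler_fps m) ^ d) $ N / of_nat l \<in> zloc l"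
  shows "rat_cong_zero (p_1m m (- of_int a / of_int b) (l * n + r)) (int l)"
proof -
  obtain H where F: "Abs_fps (p_1m m (- of_int a / of_int b)) = (euler_fps 1 * euler_fps m) ^ d * H"
    and H: "\<And>n. \<not> l dvd n \<Longrightarrow> H $ n / of_nat l \<in> zloc l" "H \<in> fps_zloc"
    using p_1m_factorization[OF m b dvd] by blast
  define E :: "rat fps" where "E = (euler_fps 1 * euler_fps m) ^ d"
  have E: "E \<in> fps_zloc" by (simp add: E_def)
  have l0: "l > 0" using prime_l by (rule prime_gt_0_nat)
  show ?thesis
  proof (rule rat_cong_zeroI)
    have "p_1m m (- of_int a / of_int b) (l * n + r) = (E * H) $ (l * n + r)"
      using arg_cong[OF F, of "\<lambda>A. A $ (l * n + r)"] by (simp add: E_def)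
    also have "\<dots> = of_nat l * (\<Sum>i=0..l * n + r. E $ i * H $ (l * n + r - i) / of_nat l)"
      using l0 by (simp add: fps_mult_nth flip: sum_divide_distrib)
    finally show "p_1m m (- of_int a / of_int b) (l * n + r)
      = of_nat l * (\<Sum>i=0..l * n + r. E $ i * H $ (l * n + r - i) / of_nat l)" .
    show "(\<Sum>i=0..l * n + r. E $ i * H $ (l * n + r - i) / of_nat l) \<in> zloc l"
    proof (rule sum_zloc)
      fix i assume i: "i \<in> {0..l * n + r}"
      show "E $ i * H $ (l * n + r - i) / of_nat l \<in> zloc l"
      proof (cases "l dvd l * n + r - i")
        case True
        then have "[l * n + r = i] (mod l)"
          using i by (simp add: cong_altdef_nat)
        moreover have "[l * n + r = r] (mod l)"
          by (simp add: unique_euclidean_semiring_class.cong_def)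
        ultimately have "[i = r] (mod l)"
          by (metis cong_sym cong_trans)
        then have "E $ i / of_nat l \<in> zloc l"
          unfolding E_def by (rule coeff)
        then show ?thesis
          using mult_zloc[OF _ fps_zlocD[OF H(2), of "l * n + r - i"]] by fastforce
      next
        case False
        then show ?thesis
          using mult_zloc[OF fps_zlocD[OF E, of i] H(1)[OF False]] by simp
      qed
    qed
  qed
qed

end

theorem theorem1p14:
  fixes a b d :: int and l r :: nat
  assumes "b \<ge> 1" and "gcd a b = 1"
    and "prime l" and "odd l" and "int l dvd a + d * b"
    and "r < l"
    and "(d = 2 \<and> [l = 3] (mod 4) \<and> [12 * r + 5 = 0] (mod l)) \<or>
         (d = 3 \<and> [l = 3] (mod 4) \<and> [8 * r + 5 = 0] (mod l))"
  shows "\<forall>n::nat. rat_cong_zero (p_1m 4 (- of_int a / of_int b) (l * n + r)) (int l)"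
proof
  fix n
  interpret prime_localization l
    by unfold_locales fact
  have l0: "l \<noteq> 0" using assms(3) by (metis not_prime_0)
  have lb: "\<not> int l dvd b"
  proof
    assume "int l dvd b"
    with assms(5) have "int l dvd a"
      by (simp add: dvd_add_left_iff)
    with \<open>int l dvd b\<close> have "int l dvd gcd a b" by simp
    with assms(2) have "l = 1" by simp
    with assms(3) show False by simp
  qed
  have shift: "int l dvd c * int N + 5"
    if "[c' * r + 5 = 0] (mod l)" "[N = r] (mod l)" "c = int c'" for c c' N
  proof -
    have "[c' * N + 5 = c' * r + 5] (mod l)"
      using that(2) by (intro cong_add cong_mult) auto
    then have "[c' * N + 5 = 0] (mod l)"
      using that(1) by (rule cong_trans)
    then have "l dvd c' * N + 5"
      by (simp add: cong_0_iff)
    then have "int l dvd int (c' * N + 5)"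
      by (simp only: int_dvd_int_iff)
    then show ?thesis by (simp add: that(3))
  qed
  from assms(7) show "rat_cong_zero (p_1m 4 (- of_int a / of_int b) (l * n + r)) (int l)"
  proof (elim disjE conjE)
    assume d: "d = 2" and l: "[l = 3] (mod 4)" and r: "[12 * r + 5 = 0] (mod l)"
    show ?thesis
    proof (rule rat_cong_zero_p_1m[where d = 2])
      fix N assume "[N = r] (mod l)"
      then have "int l dvd 12 * int N + 5"
        using shift[OF r] by simp
      then obtain u where "((euler_fps 1 * euler_fps 4) ^ 2) $ N = (of_int (int l * u) :: rat)"
        using euler_square_nth_dvd[OF assms(3) l] by blast
      then show "((euler_fps 1 * euler_fps 4) ^ 2) $ N / rat_of_nat l \<in> zloc l"
        using l0 by simp
    qed (use assms lb d in auto)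
  next
    assume d: "d = 3" and l: "[l = 3] (mod 4)" and r: "[8 * r + 5 = 0] (mod l)"
    \<comment> \<open>As \<open>l\<close> is odd, the 4 left over from Jacobi's identity is
      invertible.\<close>
    have "\<not> int l dvd 4"
    proof
      assume "int l dvd 4"
      then have "int l dvd 2 ^ 2" by simp
      then have "int l dvd 2"
        using prime_dvd_power[of "int l" 2 2] assms(3) by simp
      then have "int l dvd int 2" by simp
      then have "l dvd 2" by (simp only: int_dvd_int_iff)
      with assms(3,4) show False
        by (metis primes_dvd_imp_eq two_is_prime_nat even_numeral)
    qed
    then have inv4: "inverse 4 \<in> zloc l"
      using inverse_of_int_zloc[of 4] by simp
    show ?thesis
    proof (rule rat_cong_zero_p_1m[where d = 3])
      fix N assume "[N = r] (mod l)"
      then have "int l dvd 8 * int N + 5"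
        using shift[OF r] by simp
      then obtain u where "4 * ((euler_fps 1 * euler_fps 4) ^ 3) $ N = (of_int (int l * u) :: rat)"
        using euler_cube_nth_dvd[OF assms(3) l] by blast
      then have "((euler_fps 1 * euler_fps 4) ^ 3) $ N / rat_of_nat l = inverse 4 * of_int u"
        using l0 by (simp add: field_simps)
      then show "((euler_fps 1 * euler_fps 4) ^ 3) $ N / rat_of_nat l \<in> zloc l"
        using mult_zloc[OF inv4 of_int_zloc] by (simp only:)
    qed (use assms lb d in auto)
  qed
qed

end
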